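(* Consider the problem $$(L):\quad \min_{\mathbf{x},\mathbf{u}}\ \max_{\mathbb{P}\in\mathcal{G}}\ \mathbb{E}_{\mathbb{P}}\left[\mathbf{u}^\top\mathbf{R}\mathbf{u}+\mathbf{x}^\top\mathbf{Q}\mathbf{x}\right]\quad\text{s.t. }\mathbf{u}\in\mathcal{U}^{\mathrm{lin}}_{\boldsymbol{\eta}},\ \mathbf{x}=\mathbf{H}\mathbf{u}+\mathbf{G}\mathbf{w},$$ and its dual $$(D):\quad \max_{\mathbb{P}\in\mathcal{G}}\ \min_{\mathbf{x},\mathbf{u}}\ \mathbb{E}_{\mathbb{P}}\left[\mathbf{u}^\top\mathbf{R}\mathbf{u}+\mathbf{x}^\top\mathbf{Q}\mathbf{x}\right]\quad\text{s.t. }\mathbf{u}\in\mathcal{U}^{\mathrm{lin}}_{\boldsymbol{\eta}},\ \mathbf{x}=\mathbf{H}\mathbf{u}+\mathbf{G}\mathbf{w},$$ with all objects as in the context. Then $(D)$ is a strong dual of $(L)$, i.e. the optimal values of $(L)$ and $(D)$ coincide.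
   Context: System: $x_{t+1}=Ax_t+Bu_t+w_t$, $y_t=Cx_t+v_t$, $t=0,\dots,T-1$, with $x_t\in\mathbb{R}^n$, $u_t\in\mathbb{R}^m$, $y_t\in\mathbb{R}^p$. Weights: $Q,Q_T\in\mathbb{S}^n_+$ (positive semidefinite), $R\in\mathbb{S}^m_{++}$ (positive definite). Stacked notation: $\mathbf{x}=(x_0,\dots,x_T)$, $\mathbf{u}=(u_0,\dots,u_{T-1})$, $\mathbf{w}=(x_0,w_0,\dots,w_{T-1})$, $\mathbf{v}=(v_0,\dots,v_{T-1})$; $\mathbf{Q}=\mathrm{diag}(Q,\dots,Q,Q_T)$, $\mathbf{R}=\mathrm{diag}(R,\dots,R)$; $\mathbf{C}\in\mathbb{R}^{pT\times n(T+1)}$ is block diagonal with blocks $C$, followed by a zero last block column; $\mathbf{G}\in\mathbb{R}^{n(T+1)\times n(T+1)}$ has $(t,s)$ block $A^{t-s}$ for $0\le s\le t\le T$ and $0$ otherwise; $\mathbf{H}\in\mathbb{R}^{n(T+1)\times mT}$ has $(t,s)$ block $A^{t-1-s}B$ for $0\le s<t\le T$ and $0$ otherwise; so $\mathbf{x}=\mathbf{H}\mathbf{u}+\mathbf{G}\mathbf{w}$. The purified observations are $\boldsymbol{\eta}=\mathbf{D}\mathbf{w}+\mathbf{v}$ with $\mathbf{D}=\mathbf{C}\mathbf{G}$. $\mathcal{U}^{\mathrm{lin}}_{\boldsymbol{\eta}}$ is the class of affine policies $\mathbf{u}=\mathbf{U}\boldsymbol{\eta}+\mathbf{q}$ with $\mathbf{q}\in\mathbb{R}^{mT}$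 and $\mathbf{U}\in\mathbb{R}^{mT\times pT}$ block lower triangular (blocks of size $m\times p$). $\mathcal{G}=\mathcal{G}_{x_0}\otimes(\otimes_{t=0}^{T-1}\mathcal{G}_{w_t})\otimes(\otimes_{t=0}^{T-1}\mathcal{G}_{v_t})$ is the set of joint distributions under which $x_0,w_0,\dots,w_{T-1},v_0,\dots,v_{T-1}$ are mutually independent with marginals in the following sets of zero-mean nondegenerate Gaussian distributions: $\mathcal{G}_{x_0}=\{\mathbb{P}_{x_0}: R(\mathbb{P}_{x_0}\|\hat{\mathbb{P}}_{x_0})\le\rho_{x_0}\}$ on $\mathbb{R}^n$, $\mathcal{G}_{w_t}=\{\mathbb{P}_{w_t}:R(\mathbb{P}_{w_t}\|\hat{\mathbb{P}}_{w_t})\le\rho_{w_t}\}$ on $\mathbb{R}^n$, $\mathcal{G}_{v_t}=\{\mathbb{P}_{v_t}:R(\mathbb{P}_{v_t}\|\hat{\mathbb{P}}_{v_t})\le\rho_{v_t}\}$ on $\mathbb{R}^p$. Here $R(\mathbb{P}_2\|\mathbb{P}_1)=\int p_2\log(p_2/p_1)\,dx$ is the Kullback–Leibler divergence, the radii are nonnegative, and the nominal distributions are $\hat{\mathbb{P}}_{x_0}=\mathcal{N}(0,\hat W_{-1})$, $\hat{\mathbb{P}}_{w_t}=\mathcal{N}(0,\hat W_t)$, $\hat{\mathbb{P}}_{v_t}=\mathcal{N}(0,\hat V_t)$ with $\hat W_t,\hat V_t\succ0$. *)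

theory Defs
  imports "HOL-Probability.Probability"
begin

definition psd :: "real^'n^'n \<Rightarrow> bool" where
  "psd M \<longleftrightarrow> transpose M = M \<and> (\<forall>x. 0 \<le> x \<bullet> (M *v x))"

definition pos_def :: "real^'n^'n \<Rightarrow> bool" where
  "pos_def M \<longleftrightarrow> transpose M = M \<and> (\<forall>x. x \<noteq> 0 \<longrightarrow> 0 < x \<bullet> (M *v x))"

(* The power operation that the library provides on real^'n^'n acts componentwise. *)
definition mat_power :: "real^'n^'n \<Rightarrow> nat \<Rightarrow> real^'n^'n" where
  "mat_power A k = (((**) A) ^^ k) (mat 1)"

(* A stacked vector with N blocks is a function nat => real^'a of which only the blocks with
   index < N matter; a block matrix likewise is a function of block row and block column.
   The parameter N below is the number of blocks that are summed over. *)

definition blk_mv :: "nat \<Rightarrow> (nat \<Rightarrow> nat \<Rightarrow> real^'b^'a) \<Rightarrow> (nat \<Rightarrow> real^'b) \<Rightarrow> nat \<Rightarrow> real^'a" where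
  "blk_mv N M x = (\<lambda>t. \<Sum>s<N. M t s *v x s)"

definition blk_mm ::
  "nat \<Rightarrow> (nat \<Rightarrow> nat \<Rightarrow> real^'b^'a) \<Rightarrow> (nat \<Rightarrow> nat \<Rightarrow> real^'c^'b) \<Rightarrow> nat \<Rightarrow> nat \<Rightarrow> real^'c^'a" where
  "blk_mm N M L = (\<lambda>t s. \<Sum>k<N. M t k ** L k s)"

definition blk_quad :: "nat \<Rightarrow> (nat \<Rightarrow> nat \<Rightarrow> real^'a^'a) \<Rightarrow> (nat \<Rightarrow> real^'a) \<Rightarrow> real" where
  "blk_quad N M x = (\<Sum>t<N. x t \<bullet> blk_mv N M x t)"

definition bold_Q :: "nat \<Rightarrow> real^'n^'n \<Rightarrow> real^'n^'n \<Rightarrow> nat \<Rightarrow> nat \<Rightarrow> real^'n^'n" where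
  "bold_Q T Q QT = (\<lambda>t s. if t = s then (if t = T then QT else Q) else 0)"

definition bold_R :: "real^'m^'m \<Rightarrow> nat \<Rightarrow> nat \<Rightarrow> real^'m^'m" where
  "bold_R R = (\<lambda>t s. if t = s then R else 0)"

(* T block rows and T + 1 block columns: the last block column (s = T) is zero for rows t < T. *)
definition bold_C :: "real^'n^'p \<Rightarrow> nat \<Rightarrow> nat \<Rightarrow> real^'n^'p" where
  "bold_C C = (\<lambda>t s. if t = s then C else 0)"

definition bold_G :: "real^'n^'n \<Rightarrow> nat \<Rightarrow> nat \<Rightarrow> real^'n^'n" where
  "bold_G A = (\<lambda>t s. if s \<le> t then mat_power A (t - s) else 0)"

definition bold_H :: "real^'n^'n \<Rightarrow> real^'m^'n \<Rightarrow> nat \<Rightarrow> nat \<Rightarrow> real^'m^'n" where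
  "bold_H A B = (\<lambda>t s. if s < t then mat_power A (t - 1 - s) ** B else 0)"

definition bold_D :: "nat \<Rightarrow> real^'n^'n \<Rightarrow> real^'n^'p \<Rightarrow> nat \<Rightarrow> nat \<Rightarrow> real^'n^'p" where
  "bold_D T A C = blk_mm (T + 1) (bold_C C) (bold_G A)"

(* An outcome is a pair (w, v) of stacked vectors, with w = (x_0, w_0, ..., w_{T-1}), so that
   block 0 of w is x_0 and block t + 1 of w is w_t. *)
type_synonym ('n, 'p) outcome = "(nat \<Rightarrow> real^'n) \<times> (nat \<Rightarrow> real^'p)"

definition purified_obs ::
  "nat \<Rightarrow> real^'n^'n \<Rightarrow> real^'n^'p \<Rightarrow> ('n, 'p) outcome \<Rightarrow> nat \<Rightarrow> real^'p" where
  "purified_obs T A C = (\<lambda>(w, v) t. blk_mv (T + 1) (bold_D T A C) w t + v t)"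

definition block_lower_triangular :: "nat \<Rightarrow> (nat \<Rightarrow> nat \<Rightarrow> real^'p^'m) \<Rightarrow> bool" where
  "block_lower_triangular T U \<longleftrightarrow> (\<forall>t<T. \<forall>s<T. t < s \<longrightarrow> U t s = 0)"

definition affine_policies ::
  "nat \<Rightarrow> real^'n^'n \<Rightarrow> real^'n^'p \<Rightarrow> (('n, 'p) outcome \<Rightarrow> nat \<Rightarrow> real^'m) set" where
  "affine_policies T A C =
     {u. \<exists>U q. block_lower_triangular T U \<and>
        (\<forall>\<omega>. \<forall>t<T. u \<omega> t = blk_mv T U (purified_obs T A C \<omega>) t + q t)}"

definition feasible ::
  "nat \<Rightarrow> real^'n^'n \<Rightarrow> real^'m^'n \<Rightarrow> real^'n^'p \<Rightarrow>
    ((('n, 'p) outcome \<Rightarrow> nat \<Rightarrow> real^'n) \<times> (('n, 'p) outcome \<Rightarrow> nat \<Rightarrow> real^'m)) set" where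
  "feasible T A B C =
     {(x, u). u \<in> affine_policies T A C \<and>
        (\<forall>w v. \<forall>t\<le>T. x (w, v) t = blk_mv T (bold_H A B) (u (w, v)) t
                              + blk_mv (T + 1) (bold_G A) w t)}"

(* The integrand is a quadratic polynomial in the outcome for feasible (x, u), hence integrable
   under every distribution in the ambiguity set below. *)
definition expected_cost ::
  "nat \<Rightarrow> real^'n^'n \<Rightarrow> real^'n^'n \<Rightarrow> real^'m^'m \<Rightarrow>
    (('n, 'p) outcome \<Rightarrow> nat \<Rightarrow> real^'n) \<Rightarrow> (('n, 'p) outcome \<Rightarrow> nat \<Rightarrow> real^'m) \<Rightarrow>
    ('n, 'p) outcome measure \<Rightarrow> real" where
  "expected_cost T Q QT R x u P =
     (\<integral>\<omega>. blk_quad T (bold_R R) (u \<omega>) + blk_quad (T + 1) (bold_Q T Q QT) (x \<omega>) \<partial>P)"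

definition gaussian_density :: "real^'n^'n \<Rightarrow> real^'n \<Rightarrow> real" where
  "gaussian_density S x =
     exp (- (x \<bullet> (matrix_inv S *v x)) / 2) / sqrt ((2 * pi) ^ CARD('n) * det S)"

definition gaussian :: "real^'n^'n \<Rightarrow> (real^'n) measure" where
  "gaussian S = density lborel (\<lambda>x. ennreal (gaussian_density S x))"

(* KL_divergence b M N is the divergence of N from M, so the nominal distribution comes first. *)
definition gaussian_ball :: "real \<Rightarrow> real^'n^'n \<Rightarrow> (real^'n) measure set" where
  "gaussian_ball \<rho> S0 =
     {gaussian S | S. pos_def S \<and> KL_divergence (exp 1) (gaussian S0) (gaussian S) \<le> \<rho>}"

lemma pos_def_det_pos:
  fixes S :: "real^'n^'n"
  assumes "pos_def S"
  shows "0 < det S"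
proof (rule ccontr)
  assume neg: "\<not> 0 < det S"
  define M where "M = (\<lambda>t::real. (1 - t) *\<^sub>R mat 1 + t *\<^sub>R S)"
  have "continuous_on {0..1} (\<lambda>t. det (M t))"
  proof -
    have "det (M t) = (\<Sum>p | p permutes UNIV. of_int (sign p) *
        (\<Prod>i\<in>UNIV. (1 - t) * mat 1 $ i $ p i + t * S $ i $ p i))" for t
      by (simp add: det_def M_def)
    then show ?thesis
      by (simp only:) (intro continuous_intros)
  qed
  moreover have "det (M 1) \<le> 0" "0 \<le> det (M 0)"
    using neg by (simp_all add: M_def)
  ultimately obtain t where t: "0 \<le> t" "t \<le> 1" "det (M t) = 0"
    using IVT2'[of "\<lambda>t. det (M t)" 1 0 0] by auto
  then have "\<not> invertible (M t)"
    by (simp add: invertible_det_nz)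
  then obtain x where x: "x \<noteq> 0" "M t *v x = 0"
    unfolding invertible_left_inverse matrix_left_invertible_ker by auto
  have "M t *v x = (1 - t) *\<^sub>R x + t *\<^sub>R (S *v x)"
    by (simp add: M_def matrix_vector_mult_add_rdistrib flip: scaleR_matrix_vector_assoc)
  then have "(1 - t) * (x \<bullet> x) + t * (x \<bullet> (S *v x)) = 0"
    using x by (metis inner_add_right inner_scaleR_right inner_zero_right)
  moreover have "0 < x \<bullet> x" "0 < x \<bullet> (S *v x)"
    using x assms by (auto simp: pos_def_def)
  ultimately show False
    using t by (cases "t = 0") (auto simp: add_nonneg_eq_0_iff add_nonneg_pos less_imp_neq[symmetric])
qed

lemma gaussian_density_pos:
  assumes "pos_def S"
  shows "0 < gaussian_density S x"
  using pos_def_det_pos[OF assms] by (simp add: gaussian_density_def)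

lemma KL_divergence_gaussian:
  assumes "pos_def S1" "pos_def S2"
  shows "KL_divergence (exp 1) (gaussian S1) (gaussian S2) =
    (\<integral>x. gaussian_density S2 x * ln (gaussian_density S2 x / gaussian_density S1 x) \<partial>lborel)"
proof -
  have m: "gaussian_density S \<in> borel_measurable lborel" for S :: "real^'n^'n"
  proof -
    have "(\<lambda>x. matrix_inv S *v x) \<in> borel_measurable borel"
      by (intro borel_measurable_continuous_onI matrix_vector_mult_linear_continuous_on)
    then have "(\<lambda>x. x \<bullet> (matrix_inv S *v x)) \<in> borel_measurable borel"
      by simp
    then show ?thesis
      unfolding gaussian_density_def[abs_def] by simp
  qed
  have pos: "0 < gaussian_density S1 x" "0 < gaussian_density S2 x" for x
    using assms by (auto intro: gaussian_density_pos)
  have "KL_divergence (exp 1) (gaussian S1) (gaussian S2) =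
    (\<integral>x. gaussian_density S2 x *
         log (exp 1) (gaussian_density S2 x / gaussian_density S1 x) \<partial>lborel)"
    unfolding gaussian_def
  proof (rule lborel.KL_density_density[OF _ m _ m])
    show "1 < exp (1::real)"
      by simp
    show "AE x in lborel. 0 \<le> gaussian_density S1 x" "AE x in lborel. 0 \<le> gaussian_density S2 x"
      using pos by (auto intro: AE_I2 less_imp_le)
    show "AE x in lborel. gaussian_density S1 x = 0 \<longrightarrow> gaussian_density S2 x = 0"
      using pos(1) by (intro AE_I2) (metis less_irrefl)
  qed
  then show ?thesis
    by (simp add: log_def)
qed

(* Joint law of (x_0, w_0, ..., w_{T-1}, v_0, ..., v_{T-1}) when these are mutually independent. *)
definition joint_law ::
  "nat \<Rightarrow> (real^'n) measure \<Rightarrow> (nat \<Rightarrow> (real^'n) measure) \<Rightarrow> (nat \<Rightarrow> (real^'p) measure) \<Rightarrow>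
    ('n, 'p) outcome measure" where
  "joint_law T Px Pw Pv = PiM {..T} (case_nat Px Pw) \<Otimes>\<^sub>M PiM {..<T} Pv"

(* X0 is the nominal covariance of x_0, and W t, V t are those of w_t, v_t. *)
definition ambiguity_set ::
  "nat \<Rightarrow> real \<Rightarrow> (nat \<Rightarrow> real) \<Rightarrow> (nat \<Rightarrow> real) \<Rightarrow>
    real^'n^'n \<Rightarrow> (nat \<Rightarrow> real^'n^'n) \<Rightarrow> (nat \<Rightarrow> real^'p^'p) \<Rightarrow> ('n, 'p) outcome measure set" where
  "ambiguity_set T \<rho>x \<rho>w \<rho>v X0 W V =
     {joint_law T Px Pw Pv | Px Pw Pv.
        Px \<in> gaussian_ball \<rho>x X0 \<and>
        (\<forall>t<T. Pw t \<in> gaussian_ball (\<rho>w t) (W t)) \<and>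
        (\<forall>t<T. Pv t \<in> gaussian_ball (\<rho>v t) (V t))}"

end

theory Submission
  imports Defs
begin

text \<open>
  Under the affine policy given by \<open>U\<close> and \<open>q\<close>, all inputs and states are affine functions of the
  disturbances, so the cost is a quadratic polynomial in them.  The disturbances are independent,
  centred Gaussians, hence the expected cost depends on the law only through the covariance matrices,
  and that dependence is affine (\<open>covariance_affine_quadratic_cost\<close>).  In the policy, on the other hand,
  the cost is convex even pointwise, since the weights are positive semidefinite.  The problem is thus
  a convex-concave game between the controller, who chooses a point of a convex set of policies, and
  nature, who chooses a family of covariance matrices.

  Nature's choices form a compact convex set.  For centred Gaussians twice the divergence is
  \<open>S0\<^sup>-\<^sup>1 \<bullet> S - n + ln det S0 - ln det S\<close>, and this quantity is nonnegative for any two positive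
  definite matrices (Gibbs' inequality, \<open>ln_det_le\<close>).  That single inequality is used twice.
  Read as a family of affine upper bounds of \<open>ln det\<close> that are attained, it says that \<open>ln det\<close> is
  concave, so that a divergence ball is convex.  Applied to the reference matrix \<open>2 S0\<close>, it shows that
  a ball is bounded.  Closedness holds since a bound on the divergence keeps the determinant away from
  zero.

  The policies range over an unbounded set, but compactness of nature's side suffices for the minimax
  theorem of Ky Fan (\<open>convexlike_concavelike_minimax\<close>), which gives the equality of the two values.
  Ky Fan's form speaks of mixtures only through the payoff, so that it applies directly to policies and
  to families of covariances, which are plain functions of the outcome and of the block index.

  The Gaussian integrals reduce to products of one-dimensional integrals: a positive definite matrix
  factors as \<open>L L\<^sup>T\<close> (\<open>pos_def_factorization\<close>), and the linear change of variables by \<open>L\<close> maps the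
  standard Gaussian to the one with that covariance (\<open>gaussian_eq_distr\<close>).
\<close>

section \<open>A minimax theorem for convex-concave-like functions\<close>

text \<open>
  The pairs of values that lie below \<open>(g y, h y)\<close> for some \<open>y\<close> form a convex set in the plane.
  By compactness it misses an open quadrant whose corner \<open>(m, m)\<close> lies strictly below \<open>(v, v)\<close>,
  and the weights are the coefficients of a line that separates the two sets.
\<close>

lemma concavelike_pair:
  fixes g h :: "'b::topological_space \<Rightarrow> real"
  assumes Y: "compact Y" and g: "continuous_on Y g" and h: "continuous_on Y h"
    and mix: "\<And>y y' a. y \<in> Y \<Longrightarrow> y' \<in> Y \<Longrightarrow> 0 \<le> a \<Longrightarrow> a \<le> 1 \<Longrightarrow>
        \<exists>z\<in>Y. a * g y + (1 - a) * g y' \<le> g z \<and> a * h y + (1 - a) * h y' \<le> h z"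
    and below: "\<And>y. y \<in> Y \<Longrightarrow> g y < v \<or> h y < v"
  shows "\<exists>a. 0 \<le> a \<and> a \<le> 1 \<and> (\<forall>y\<in>Y. a * g y + (1 - a) * h y < v)"
proof (cases "Y = {}")
  case True
  then show ?thesis by (intro exI[of _ 0]) auto
next
  case False
  have "continuous_on Y (\<lambda>y. min (g y) (h y))"
    using g h by (intro continuous_intros)
  then obtain y0 where y0: "y0 \<in> Y" "\<And>y. y \<in> Y \<Longrightarrow> min (g y) (h y) \<le> min (g y0) (h y0)"
    using continuous_attains_sup[OF Y False] by blast
  define m where "m = min (g y0) (h y0)"
  have mv: "m < v"
    using below[OF y0(1)] by (auto simp: m_def)
  define D where "D = {p::real\<times>real. \<exists>y\<in>Y. fst p \<le> g y \<and> snd p \<le> h y}"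
  define E where "E = {p::real\<times>real. m < fst p \<and> m < snd p}"
  have D_I: "(r, s) \<in> D" if "y \<in> Y" "r \<le> g y" "s \<le> h y" for r s y
    using that by (auto simp: D_def)
  have "convex D"
  proof (rule convexI)
    fix p q :: "real\<times>real" and a b :: real
    assume pq: "p \<in> D" "q \<in> D" and ab: "0 \<le> a" "0 \<le> b" "a + b = 1"
    obtain y where y: "y \<in> Y" "fst p \<le> g y" "snd p \<le> h y"
      using pq by (auto simp: D_def)
    obtain y' where y': "y' \<in> Y" "fst q \<le> g y'" "snd q \<le> h y'"
      using pq by (auto simp: D_def)
    have b: "b = 1 - a" "a \<le> 1" using ab by auto
    obtain z where z: "z \<in> Y" "a * g y + b * g y' \<le> g z" "a * h y + b * h y' \<le> h z"
      using mix[OF y(1) y'(1) ab(1) b(2)] b(1) by blast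
    have "a * fst p + b * fst q \<le> a * g y + b * g y'" "a * snd p + b * snd q \<le> a * h y + b * h y'"
      using y y' ab by (auto intro!: add_mono mult_left_mono)
    then show "a *\<^sub>R p + b *\<^sub>R q \<in> D"
      using z by (auto simp: D_def intro!: bexI[of _ z])
  qed
  moreover have "convex E"
  proof (rule convexI)
    fix p q :: "real\<times>real" and a b :: real
    assume pq: "p \<in> E" "q \<in> E" and ab: "0 \<le> a" "0 \<le> b" "a + b = 1"
    have "m < a * r + b * s" if "m < r" "m < s" for r s
      using convex_bound_lt[of "- r" "- m" "- s" a b] that ab by simp
    then show "a *\<^sub>R p + b *\<^sub>R q \<in> E"
      using pq by (auto simp: E_def)
  qed
  moreover have "D \<noteq> {}"
    using D_I[OF y0(1) order.refl order.refl] by auto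
  moreover have "(m + 1, m + 1) \<in> E"
    by (simp add: E_def)
  then have "E \<noteq> {}" by auto
  moreover have "D \<inter> E = {}"
    using y0 by (force simp: D_def E_def m_def)
  ultimately obtain c b where c: "c \<noteq> 0" and cD: "\<And>p. p \<in> D \<Longrightarrow> c \<bullet> p \<le> b"
    and cE: "\<And>p. p \<in> E \<Longrightarrow> b \<le> c \<bullet> p"
    using separating_hyperplane_sets[of D E] by blast
  obtain c1 c2 where c12: "c = (c1, c2)" by (cases c)
  have le: "c1 * g y + c2 * h y \<le> (c1 + c2) * m + e * (c1 + c2)" if "y \<in> Y" "0 < e" for y e
    using cD[OF D_I[OF that(1) order.refl order.refl]] cE[of "(m + e, m + e)"] that(2)
    by (auto simp: c12 E_def algebra_simps)
  have tail: "c1 * (g y0 - r) + c2 * (h y0 - s) \<le> (c1 + c2) * m + (c1 + c2)" if "0 \<le> r" "0 \<le> s" for r s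
    using cD[OF D_I[OF y0(1), of "g y0 - r" "h y0 - s"]] cE[of "(m + 1, m + 1)"] that
    by (auto simp: c12 E_def algebra_simps)
  \<comment> \<open>\<open>D\<close> is closed downwards in both coordinates, so the normal of the separating line is nonnegative.\<close>
  have nonneg: "0 \<le> k" if "\<And>r. 0 \<le> r \<Longrightarrow> A - k * r \<le> B" for k A B :: real
  proof (rule ccontr)
    assume "\<not> 0 \<le> k"
    then have "A - k * ((\<bar>B - A\<bar> + 1) / - k) \<le> B"
      by (intro that) (auto simp: divide_nonneg_neg)
    moreover have "k * ((\<bar>B - A\<bar> + 1) / - k) = - (\<bar>B - A\<bar> + 1)"
      using \<open>\<not> 0 \<le> k\<close> by simp
    ultimately show False
      by linarith
  qed
  have "0 \<le> c1"
    by (rule nonneg[of "c1 * g y0 + c2 * h y0" _ "(c1 + c2) * m + (c1 + c2)"])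
       (use tail[of _ 0] in \<open>simp add: algebra_simps\<close>)
  moreover have "0 \<le> c2"
    by (rule nonneg[of "c1 * g y0 + c2 * h y0" _ "(c1 + c2) * m + (c1 + c2)"])
       (use tail[of 0] in \<open>simp add: algebra_simps\<close>)
  moreover have "c1 \<noteq> 0 \<or> c2 \<noteq> 0"
    using c by (auto simp: c12 zero_prod_def)
  ultimately have pos: "0 < c1 + c2" "0 \<le> c1" "0 \<le> c2" by auto
  define a where "a = c1 / (c1 + c2)"
  have a: "0 \<le> a" "a \<le> 1" "1 - a = c2 / (c1 + c2)"
    using pos by (auto simp: a_def field_simps)
  have "a * g y + (1 - a) * h y < v" if "y \<in> Y" for y
  proof -
    have "a * g y + (1 - a) * h y = (c1 * g y + c2 * h y) / (c1 + c2)"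
      unfolding a(3) by (simp add: a_def add_divide_distrib)
    also have "\<dots> \<le> ((c1 + c2) * m + (v - m) / 2 * (c1 + c2)) / (c1 + c2)"
      using le[OF that, of "(v - m) / 2"] pos mv by (intro divide_right_mono) auto
    also have "\<dots> = (m + v) / 2"
      using pos by (simp add: field_simps)
    also have "\<dots> < v" using mv by simp
    finally show ?thesis .
  qed
  then show ?thesis using a by blast
qed

text \<open>
  Induction on the number of replies. The last reply \<open>k\<close> already beats every \<open>y\<close> outside the set where
  \<open>f k\<close> is at least \<open>v\<close>; that set is again compact and closed under mixtures, so by induction a single
  strategy beats all of it. The previous lemma gives weights for these two strategies, and a mixture of
  them in \<open>X\<close> does at least as well.
\<close>

lemma finite_strategies_suffice:
  fixes f :: "'a \<Rightarrow> 'b::topological_space \<Rightarrow> real"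
  assumes "finite F" "F \<subseteq> X" "X \<noteq> {}" "compact Y"
    and "\<And>x. x \<in> X \<Longrightarrow> continuous_on Y (f x)"
    and "\<And>x x' a. x \<in> X \<Longrightarrow> x' \<in> X \<Longrightarrow> 0 \<le> a \<Longrightarrow> a \<le> 1 \<Longrightarrow>
          \<exists>z\<in>X. \<forall>y\<in>Y. f z y \<le> a * f x y + (1 - a) * f x' y"
    and "\<And>y y' a. y \<in> Y \<Longrightarrow> y' \<in> Y \<Longrightarrow> 0 \<le> a \<Longrightarrow> a \<le> 1 \<Longrightarrow>
          \<exists>z\<in>Y. \<forall>x\<in>X. a * f x y + (1 - a) * f x y' \<le> f x z"
    and "\<And>y. y \<in> Y \<Longrightarrow> \<exists>x\<in>F. f x y < v"
  shows "\<exists>x\<in>X. \<forall>y\<in>Y. f x y < v"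
  using assms
proof (induction F arbitrary: Y rule: finite_induct)
  case empty
  then have "Y = {}" by blast
  then show ?case using empty.prems(2) by blast
next
  case (insert k F)
  note cont = insert.prems(4) and cvx = insert.prems(5) and ccv = insert.prems(6)
  have k: "k \<in> X" and F: "F \<subseteq> X" using insert.prems by auto
  define Y' where "Y' = {y \<in> Y. v \<le> f k y}"
  have "closedin (top_of_set Y) (Y \<inter> f k -` {v..})"
    by (rule continuous_closedin_preimage[OF cont[OF k]]) auto
  then have "compact Y'"
    using closedin_compact[OF insert.prems(3)] by (simp add: Y'_def vimage_def Int_def)
  moreover have "\<exists>z\<in>Y'. \<forall>x\<in>X. a * f x y + (1 - a) * f x y' \<le> f x z"
    if y: "y \<in> Y'" "y' \<in> Y'" and a: "0 \<le> a" "a \<le> 1" for y y' a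
  proof -
    obtain z where z: "z \<in> Y" "\<And>x. x \<in> X \<Longrightarrow> a * f x y + (1 - a) * f x y' \<le> f x z"
      using ccv[of y y' a] y a by (auto simp: Y'_def)
    have "v \<le> a * f k y + (1 - a) * f k y'"
      using convex_bound_le[of "- f k y" "-v" "- f k y'" a "1 - a"] y a by (auto simp: Y'_def)
    then show ?thesis
      using z z(2)[OF k] by (auto simp: Y'_def)
  qed
  moreover have "\<exists>x\<in>F. f x y < v" if "y \<in> Y'" for y
    using insert.prems(7)[of y] that by (auto simp: Y'_def)
  moreover have "continuous_on Y' (f x)" if "x \<in> X" for x
    using cont[OF that] by (rule continuous_on_subset) (auto simp: Y'_def)
  moreover have "\<exists>z\<in>X. \<forall>y\<in>Y'. f z y \<le> a * f x y + (1 - a) * f x' y"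
    if "x \<in> X" "x' \<in> X" "0 \<le> a" "a \<le> 1" for x x' a
    using cvx[OF that] by (auto simp: Y'_def)
  ultimately have "\<exists>x\<in>X. \<forall>y\<in>Y'. f x y < v"
    by (intro insert.IH[OF F insert.prems(2)])
  then obtain x where x: "x \<in> X" "\<And>y. y \<in> Y' \<Longrightarrow> f x y < v"
    by blast
  have "\<exists>a. 0 \<le> a \<and> a \<le> 1 \<and> (\<forall>y\<in>Y. a * f x y + (1 - a) * f k y < v)"
  proof (rule concavelike_pair[OF insert.prems(3) cont[OF x(1)] cont[OF k]])
    fix y y' a assume "y \<in> Y" "y' \<in> Y" "0 \<le> (a::real)" "a \<le> 1"
    from ccv[OF this] show "\<exists>z\<in>Y. a * f x y + (1 - a) * f x y' \<le> f x z \<and>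
        a * f k y + (1 - a) * f k y' \<le> f k z"
      using x(1) k by blast
  next
    show "f x y < v \<or> f k y < v" if "y \<in> Y" for y
      using x(2)[of y] that by (auto simp: Y'_def not_le)
  qed
  then obtain a where a: "0 \<le> a" "a \<le> 1" "\<And>y. y \<in> Y \<Longrightarrow> a * f x y + (1 - a) * f k y < v"
    by blast
  then show ?case
    using cvx[OF x(1) k a(1,2)] by (meson order.strict_trans1)
qed

text \<open>
  Ky Fan's theorem. Above any \<open>v\<close> that bounds the lower value, each \<open>y\<close> has a good reply; compactness
  leaves finitely many of these, and they can be mixed into one strategy that is good against all \<open>y\<close>.
\<close>

theorem convexlike_concavelike_minimax:
  fixes f :: "'a \<Rightarrow> 'b::topological_space \<Rightarrow> real"
  assumes X: "X \<noteq> {}" and Y: "compact Y"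
    and cont: "\<And>x. x \<in> X \<Longrightarrow> continuous_on Y (f x)"
    and cvx: "\<And>x x' a. x \<in> X \<Longrightarrow> x' \<in> X \<Longrightarrow> 0 \<le> a \<Longrightarrow> a \<le> 1 \<Longrightarrow>
          \<exists>z\<in>X. \<forall>y\<in>Y. f z y \<le> a * f x y + (1 - a) * f x' y"
    and ccv: "\<And>y y' a. y \<in> Y \<Longrightarrow> y' \<in> Y \<Longrightarrow> 0 \<le> a \<Longrightarrow> a \<le> 1 \<Longrightarrow>
          \<exists>z\<in>Y. \<forall>x\<in>X. a * f x y + (1 - a) * f x y' \<le> f x z"
  shows "(INF x\<in>X. SUP y\<in>Y. ereal (f x y)) = (SUP y\<in>Y. INF x\<in>X. ereal (f x y))"
proof (rule antisym)
  show "(SUP y\<in>Y. INF x\<in>X. ereal (f x y)) \<le> (INF x\<in>X. SUP y\<in>Y. ereal (f x y))"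
    by (intro SUP_least INF_greatest) (rule order_trans[OF INF_lower SUP_upper])
  show "(INF x\<in>X. SUP y\<in>Y. ereal (f x y)) \<le> (SUP y\<in>Y. INF x\<in>X. ereal (f x y))"
  proof (rule ereal_le_real)
    fix v :: real
    assume v: "(SUP y\<in>Y. INF x\<in>X. ereal (f x y)) \<le> ereal v"
    have "(INF x\<in>X. SUP y\<in>Y. ereal (f x y)) \<le> ereal v + ereal e" if e: "0 < e" for e
    proof -
      have "\<exists>x\<in>X. f x y < v + e" if "y \<in> Y" for y
      proof -
        have "(INF x\<in>X. ereal (f x y)) \<le> ereal v"
          using v that by (meson SUP_upper order_trans)
        also have "ereal v < ereal (v + e)" using e by simp
        finally show ?thesis by (auto simp: INF_less_iff)
      qed
      then obtain s where s: "\<And>y. y \<in> Y \<Longrightarrow> s y \<in> X \<and> f (s y) y < v + e" by metis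
      \<comment> \<open>Each reply beats a relatively open set of opponents, so finitely many replies suffice.\<close>
      have "\<exists>U. open U \<and> {z \<in> Y. f (s y) z < v + e} = Y \<inter> U" if "y \<in> Y" for y
      proof -
        have "openin (top_of_set Y) (Y \<inter> f (s y) -` {..<v + e})"
          using s[OF that] by (intro continuous_openin_preimage_gen cont) auto
        then show ?thesis
          by (auto simp: openin_open vimage_def Int_def)
      qed
      then obtain U where U: "\<And>y. y \<in> Y \<Longrightarrow> open (U y)"
        "\<And>y. y \<in> Y \<Longrightarrow> {z \<in> Y. f (s y) z < v + e} = Y \<inter> U y" by metis
      have cover: "Y \<subseteq> (\<Union>y\<in>Y. U y)"
        using s U(2) by blast
      obtain N where N: "N \<subseteq> Y" "finite N" "Y \<subseteq> (\<Union>y\<in>N. U y)"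
        by (rule compactE_image[OF Y _ cover]) (use U(1) in auto)
      have "\<exists>x\<in>s ` N. f x y < v + e" if "y \<in> Y" for y
        using N U(2) that by blast
      moreover have "s ` N \<subseteq> X" using N(1) s by auto
      ultimately have "\<exists>x\<in>X. \<forall>y\<in>Y. f x y < v + e"
        by (intro finite_strategies_suffice[OF finite_imageI[OF N(2)] _ X Y cont cvx ccv])
      then obtain x where x: "x \<in> X" "\<And>y. y \<in> Y \<Longrightarrow> f x y < v + e"
        by blast
      have "(INF x\<in>X. SUP y\<in>Y. ereal (f x y)) \<le> (SUP y\<in>Y. ereal (f x y))"
        using x(1) by (rule INF_lower)
      also have "\<dots> \<le> ereal v + ereal e"
        using x(2) by (intro SUP_least) (auto intro: less_imp_le)
      finally show ?thesis .
    qed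
    then show "(INF x\<in>X. SUP y\<in>Y. ereal (f x y)) \<le> ereal v"
      by (rule ereal_le_epsilon2)
  qed
qed

section \<open>Linear change of variables for Lebesgue measure\<close>

definition shear :: "'n \<Rightarrow> 'n \<Rightarrow> real \<Rightarrow> real^'n^'n" where
  "shear m n c = (\<chi> i j. if i = m \<and> j = n then c else of_bool (i = j))"

lemma shear_mv:
  assumes "m \<noteq> n"
  shows "shear m n c *v x = (\<chi> i. if i = m then x $ m + c * x $ n else x $ i)"
proof -
  have "(\<Sum>j\<in>UNIV. (if i = m \<and> j = n then c else of_bool (i = j)) * x $ j) =
      (if i = m then x $ m + c * x $ n else x $ i)" for i
  proof (cases "i = m")
    case True
    have "(\<Sum>j\<in>UNIV. (if i = m \<and> j = n then c else of_bool (i = j)) * x $ j) =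
        (\<Sum>j\<in>UNIV. (if j = n then c * x $ j else 0) + (if j = m then x $ j else 0))"
      using assms True by (intro sum.cong) auto
    then show ?thesis using True by (simp add: sum.distrib)
  next
    case False
    have "(\<Sum>j\<in>UNIV. (if i = m \<and> j = n then c else of_bool (i = j)) * x $ j) =
        (\<Sum>j\<in>UNIV. if j = i then x $ j else 0)"
      using False by (intro sum.cong) auto
    then show ?thesis using False by simp
  qed
  then show ?thesis
    by (simp add: shear_def matrix_vector_mult_def)
qed

text \<open>
  A shear is the identity matrix after one row operation.
\<close>

lemma det_shear:
  assumes "m \<noteq> n"
  shows "det (shear m n c) = 1"
proof -
  have "(\<chi> k. if k = m then row m (mat 1) + c *s row n (mat 1) else row k (mat 1)) = shear m n c"
    using assms by (auto simp: shear_def vec_eq_iff row_def mat_def)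
  then show ?thesis
    using det_row_operation[OF assms, of "mat 1" c] by simp
qed

lemma axis_nth_eq: "axis i x $ j = (if j = i then x else 0)"
  by (simp add: axis_def)

lemma Basis_cart_eq: "(Basis :: (real^'n) set) = range (\<lambda>i. axis i 1)"
  by (auto simp: Basis_vec_def)

text \<open>
  Integrate over coordinate \<open>m\<close> first: with all other coordinates fixed, the shear is a translation of
  that coordinate.
\<close>

lemma nn_integral_shear:
  fixes g :: "real^'n \<Rightarrow> ennreal"
  assumes [measurable]: "g \<in> borel_measurable borel" and mn: "m \<noteq> n"
  shows "(\<integral>\<^sup>+x. g (shear m n c *v x) \<partial>lborel) = (\<integral>\<^sup>+x. g x \<partial>lborel)"
proof -
  interpret product_sigma_finite "\<lambda>_::real^'n. lborel :: real measure"
    by standard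
  let ?m = "axis m 1 :: real^'n" and ?n = "axis n 1 :: real^'n"
  define B where "B = (Basis :: (real^'n) set) - {?m}"
  have B: "Basis = insert ?m B" "?m \<notin> B" "finite B" "?n \<in> B"
    using mn by (auto simp: B_def Basis_cart_eq axis_eq_axis)
  define \<Sigma> where "\<Sigma> = (\<lambda>f. \<Sum>b\<in>insert ?m B. f b *\<^sub>R b)"
  have [measurable]: "\<Sigma> \<in> PiM (insert ?m B) (\<lambda>_. lborel) \<rightarrow>\<^sub>M borel"
    unfolding \<Sigma>_def by measurable
  have split: "(\<integral>\<^sup>+x. h x \<partial>lborel) = (\<integral>\<^sup>+ f. (\<integral>\<^sup>+ y. h (\<Sigma> (f(?m := y))) \<partial>lborel) \<partial>PiM B (\<lambda>_. lborel))"
    if [measurable]: "h \<in> borel_measurable borel" for h :: "real^'n \<Rightarrow> ennreal"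
  proof -
    have "(\<integral>\<^sup>+x. h x \<partial>lborel) = (\<integral>\<^sup>+ f. h (\<Sigma> f) \<partial>PiM (insert ?m B) (\<lambda>_. lborel))"
      unfolding lborel_eq[where 'a = "real^'n"] \<Sigma>_def[symmetric] B(1) by (rule nn_integral_distr) auto
    also have "\<dots> = (\<integral>\<^sup>+ f. (\<integral>\<^sup>+ y. h (\<Sigma> (f(?m := y))) \<partial>lborel) \<partial>PiM B (\<lambda>_. lborel))"
      by (rule product_nn_integral_insert) (use B(2,3) in auto)
    finally show ?thesis .
  qed
  have [measurable]: "(\<lambda>x. shear m n c *v x) \<in> borel_measurable borel"
    by (intro borel_measurable_continuous_onI matrix_vector_mult_linear_continuous_on)
  have shift: "shear m n c *v \<Sigma> (f(?m := y)) = \<Sigma> (f(?m := c * f ?n + 1 * y))" for f y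
  proof -
    have *: "\<Sigma> (f(?m := z)) = z *\<^sub>R ?m + (\<Sum>b\<in>B. f b *\<^sub>R b)" for z
      using B(2,3) by (auto simp: \<Sigma>_def intro!: sum.cong)
    have comp: "(\<Sum>b\<in>B. f b * b $ i) = (if i = m then 0 else f (axis i 1))" for i
    proof -
      have "(\<Sum>b\<in>B. f b * b $ i) = (\<Sum>b\<in>B. if b = axis i 1 then f (axis i 1) else 0)"
      proof (intro sum.cong refl)
        fix b assume "b \<in> B"
        then obtain j where "b = axis j 1" by (auto simp: B_def Basis_cart_eq)
        then show "f b * b $ i = (if b = axis i 1 then f (axis i 1) else 0)"
          by (auto simp: axis_nth_eq axis_eq_axis)
      qed
      then show ?thesis
        using B(3) by (auto simp: B_def Basis_cart_eq axis_eq_axis)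
    qed
    show ?thesis
      using mn by (auto simp: shear_mv[OF mn] * vec_eq_iff comp axis_nth_eq)
  qed
  have "(\<integral>\<^sup>+x. g (shear m n c *v x) \<partial>lborel) =
      (\<integral>\<^sup>+ f. (\<integral>\<^sup>+ y. g (\<Sigma> (f(?m := c * f ?n + 1 * y))) \<partial>lborel) \<partial>PiM B (\<lambda>_. lborel))"
    by (subst split) (simp_all only: shift, measurable)
  also have "\<dots> = (\<integral>\<^sup>+ f. (\<integral>\<^sup>+ y. g (\<Sigma> (f(?m := y))) \<partial>lborel) \<partial>PiM B (\<lambda>_. lborel))"
  proof (rule nn_integral_cong)
    fix f assume f: "f \<in> space (PiM B (\<lambda>_. lborel :: real measure))"
    have "(\<lambda>y. \<Sigma> (f(?m := y))) \<in> borel_measurable borel"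
      unfolding \<Sigma>_def by (intro borel_measurable_sum) auto
    then have "(\<lambda>y. g (\<Sigma> (f(?m := y)))) \<in> borel_measurable borel"
      by measurable
    from nn_integral_real_affine[OF this, of 1 "c * f ?n"]
    show "(\<integral>\<^sup>+ y. g (\<Sigma> (f(?m := c * f ?n + 1 * y))) \<partial>lborel) = (\<integral>\<^sup>+ y. g (\<Sigma> (f(?m := y))) \<partial>lborel)"
      by simp
  qed
  also have "\<dots> = (\<integral>\<^sup>+x. g x \<partial>lborel)"
    by (rule split[symmetric]) fact
  finally show ?thesis .
qed

lemma nn_integral_diagonal:
  fixes g :: "real^'n \<Rightarrow> ennreal"
  assumes [measurable]: "g \<in> borel_measurable borel"
    and diag: "\<And>i j. i \<noteq> j \<Longrightarrow> A $ i $ j = 0" and "det A \<noteq> 0"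
  shows "(\<integral>\<^sup>+x. g x \<partial>lborel) = ennreal \<bar>det A\<bar> * (\<integral>\<^sup>+x. g (A *v x) \<partial>lborel)"
proof -
  have det: "det A = (\<Prod>i\<in>UNIV. A $ i $ i)"
    by (rule det_diagonal) (rule diag)
  then have nz: "A $ i $ i \<noteq> 0" for i
    using assms(3) by auto
  define c where "c = (\<lambda>b. \<Sum>i\<in>UNIV. A $ i $ i * b $ i)"
  have c: "c (axis i 1) = A $ i $ i" for i
    by (simp add: c_def axis_nth_eq if_distrib cong: if_cong)
  have inj: "inj (\<lambda>i. axis i 1 :: real^'n)"
    by (auto simp: inj_def axis_eq_axis)
  have T: "0 + (\<Sum>j\<in>Basis. (c j * (x \<bullet> j)) *\<^sub>R j) = A *v x" for x :: "real^'n"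
  proof -
    have "(A *v x) $ i = A $ i $ i * x $ i" for i
    proof -
      have "(A *v x) $ i = (\<Sum>j\<in>UNIV. if j = i then A $ i $ i * x $ i else 0)"
        unfolding matrix_vector_mult_def vec_lambda_beta by (intro sum.cong) (auto simp: diag)
      then show ?thesis by simp
    qed
    moreover have "(\<Sum>j\<in>Basis. (c j * (x \<bullet> j)) *\<^sub>R j) $ i = A $ i $ i * x $ i" for i
      unfolding Basis_cart_eq sum.reindex[OF inj]
      by (simp add: c inner_axis axis_nth_eq if_distrib cong: if_cong)
    ultimately show ?thesis by (simp add: vec_eq_iff)
  qed
  have [measurable]: "(\<lambda>x. A *v x) \<in> borel_measurable borel"
    by (intro borel_measurable_continuous_onI matrix_vector_mult_linear_continuous_on)
  have "c j \<noteq> 0" if "j \<in> Basis" for j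
    using that nz by (auto simp: Basis_cart_eq c)
  then have "lborel = density (distr lborel borel ((*v) A)) (\<lambda>_. ennreal (\<Prod>j\<in>Basis. \<bar>c j\<bar>))"
    using lborel_affine_euclidean[of c 0] unfolding T by blast
  also have "(\<Prod>j\<in>Basis. \<bar>c j\<bar>) = \<bar>det A\<bar>"
    unfolding Basis_cart_eq prod.reindex[OF inj] det by (simp add: c abs_prod)
  finally have l: "lborel = density (distr lborel borel ((*v) A)) (\<lambda>_. ennreal \<bar>det A\<bar>)" .
  show ?thesis
    by (subst l) (simp add: nn_integral_density nn_integral_distr nn_integral_cmult)
qed

text \<open>
  The rule holds for a product of matrices if it holds for the factors, so that elementary
  matrices suffice. Decomposing them into shears and diagonal matrices avoids any choice of an order
  on the index type, which triangular determinants would require.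
\<close>

lemma nn_integral_lborel_matrix:
  fixes g :: "real^'n \<Rightarrow> ennreal"
  assumes "g \<in> borel_measurable borel" and "det A \<noteq> 0"
  shows "(\<integral>\<^sup>+x. g x \<partial>lborel) = ennreal \<bar>det A\<bar> * (\<integral>\<^sup>+x. g (A *v x) \<partial>lborel)"
proof -
  define P where "P = (\<lambda>A::real^'n^'n. det A \<noteq> 0 \<longrightarrow> (\<forall>g\<in>borel_measurable borel.
      (\<integral>\<^sup>+x. g x \<partial>lborel) = ennreal \<bar>det A\<bar> * (\<integral>\<^sup>+x. g (A *v x) \<partial>lborel)))"
  have P_D: "(\<integral>\<^sup>+x. g x \<partial>lborel) = ennreal \<bar>det A\<bar> * (\<integral>\<^sup>+x. g (A *v x) \<partial>lborel)"
    if "P A" "det A \<noteq> 0" "g \<in> borel_measurable borel" for A g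
    using bspec[OF mp[OF that(1)[unfolded P_def] that(2)] that(3)] .
  have mult: "P (A ** B)" if "P A" "P B" for A B
  unfolding P_def
  proof (intro impI ballI)
    fix g :: "real^'n \<Rightarrow> ennreal" assume [measurable]: "g \<in> borel_measurable borel" and nz: "det (A ** B) \<noteq> 0"
    have [measurable]: "(\<lambda>x. A *v x) \<in> borel_measurable borel"
      by (intro borel_measurable_continuous_onI matrix_vector_mult_linear_continuous_on)
    have "(\<integral>\<^sup>+x. g x \<partial>lborel) = ennreal \<bar>det A\<bar> * (\<integral>\<^sup>+x. g (A *v x) \<partial>lborel)"
      using nz by (intro P_D that(1)) (auto simp: det_mul)
    also have "(\<integral>\<^sup>+x. g (A *v x) \<partial>lborel) = ennreal \<bar>det B\<bar> * (\<integral>\<^sup>+x. g (A *v (B *v x)) \<partial>lborel)"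
      using nz by (intro P_D[where g = "\<lambda>x. g (A *v x)"] that(2)) (auto simp: det_mul)
    finally show "(\<integral>\<^sup>+x. g x \<partial>lborel) = ennreal \<bar>det (A ** B)\<bar> * (\<integral>\<^sup>+x. g ((A ** B) *v x) \<partial>lborel)"
      by (simp add: det_mul abs_mult ennreal_mult' mult.assoc matrix_vector_mul_assoc)
  qed
  have diagonal: "P A" if "\<And>i j. i \<noteq> j \<Longrightarrow> A $ i $ j = 0" for A
    unfolding P_def using nn_integral_diagonal[OF _ that] by blast
  have sh: "P (shear m n c)" if "m \<noteq> n" for m n c
    by (simp add: P_def det_shear[OF that] nn_integral_shear[OF _ that])
  have "P A"
  proof (rule induct_matrix_elementary[of P])
    fix m n :: 'n assume mn: "m \<noteq> n"
    define D :: "real^'n^'n" where "D = (\<chi> i j. if i = j then (if i = n then -1 else 1) else 0)"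
    have D: "D *v x = (\<chi> i. if i = n then - x $ i else x $ i)" for x
      by (auto simp: D_def matrix_vector_mult_def vec_eq_iff if_distrib[of "\<lambda>t. t * _"] sum_negf cong: if_cong)
    \<comment> \<open>A transposition is a product of shears and one reflection:
      \<open>(a, b) \<mapsto> (a + b, b) \<mapsto> (a + b, -a) \<mapsto> (b, -a) \<mapsto> (b, a)\<close>\<close>
    have eq: "(\<chi> i j. mat 1 $ i $ Transposition.transpose m n j) =
        D ** (shear m n 1 ** (shear n m (-1) ** shear m n 1))"
      unfolding matrix_eq
    proof
      fix x :: "real^'n"
      have "(\<chi> i j. mat 1 $ i $ Transposition.transpose m n j) *v x = (\<chi> i. x $ Transposition.transpose m n i)"
      proof -
        have "(\<Sum>j\<in>UNIV. mat 1 $ i $ Transposition.transpose m n j * x $ j) =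
            (\<Sum>j\<in>UNIV. if j = Transposition.transpose m n i then x $ j else 0)" for i
          by (intro sum.cong) (auto simp: mat_def transpose_eq_iff)
        then show ?thesis by (simp add: matrix_vector_mult_def)
      qed
      also have "\<dots> = (D ** (shear m n 1 ** (shear n m (-1) ** shear m n 1))) *v x"
        using mn by (auto simp: D shear_mv matrix_vector_mul_assoc[symmetric] vec_eq_iff transpose_def)
      finally show "(\<chi> i j. mat 1 $ i $ Transposition.transpose m n j) *v x =
          (D ** (shear m n 1 ** (shear n m (-1) ** shear m n 1))) *v x" .
    qed
    have "P D" by (rule diagonal) (simp add: D_def)
    then have "P (D ** (shear m n 1 ** (shear n m (-1) ** shear m n 1)))"
      using mn by (intro mult sh) auto
    then show "P (\<chi> i j. mat 1 $ i $ Transposition.transpose m n j)"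
      unfolding eq .
  next
    show "P A" if "row i A = 0" for A i
      unfolding P_def using det_zero_row(2)[OF that] by blast
  next
    show "P (\<chi> i j. if i = m \<and> j = n then c else of_bool (i = j))" if "m \<noteq> n" for m n c
      using sh[OF that, of c] unfolding shear_def .
  qed (fact mult diagonal)+
  then show ?thesis
    using assms(2,1) by (rule P_D)
qed

section \<open>Factorization of positive definite matrices and Gaussian measures\<close>

lemma inner_symmetric_mv:
  fixes S :: "real^'n^'n"
  assumes "transpose S = S"
  shows "a \<bullet> (S *v b) = (S *v a) \<bullet> b"
  using dot_lmul_matrix[of a S b] transpose_matrix_vector[of S a] assms by simp

lemma inner_vm:
  fixes L :: "real^'n^'m"
  shows "a \<bullet> (b v* L) = (L *v a) \<bullet> b"
  using dot_lmul_matrix[of b L a] by (simp add: inner_commute)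

text \<open>
  Gram-Schmidt for the inner product \<open>(x, y) \<mapsto> x \<bullet> S y\<close>: as long as fewer than \<open>n\<close> vectors are
  chosen, some nonzero vector is orthogonal to their images under \<open>S\<close>.
\<close>

lemma exists_orthonormal_family:
  fixes S :: "real^'n^'n"
  assumes S: "pos_def S"
  shows "\<exists>b :: 'n \<Rightarrow> real^'n. \<forall>i j. b i \<bullet> (S *v b j) = (if i = j then 1 else 0)"
proof -
  have sym: "transpose S = S" and pos: "\<And>x. x \<noteq> 0 \<Longrightarrow> 0 < x \<bullet> (S *v x)"
    using S by (auto simp: pos_def_def)
  have "finite J \<Longrightarrow> \<exists>b :: 'n \<Rightarrow> real^'n. \<forall>i\<in>J. \<forall>j\<in>J. b i \<bullet> (S *v b j) = (if i = j then 1 else 0)" for J :: "'n set"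
  proof (induction J rule: finite_induct)
    case empty
    then show ?case by auto
  next
    case (insert k J)
    then obtain b :: "'n \<Rightarrow> real^'n" where
      b: "\<And>i j. i \<in> J \<Longrightarrow> j \<in> J \<Longrightarrow> b i \<bullet> (S *v b j) = (if i = j then 1 else 0)" by blast
    let ?V = "(\<lambda>i. S *v b i) ` J"
    have "dim ?V \<le> card ?V"
      using insert.hyps(1) by (intro dim_le_card') auto
    also have "\<dots> \<le> card J"
      using insert.hyps(1) by (rule card_image_le)
    also have "\<dots> < CARD('n)"
      using insert.hyps(2) by (intro psubset_card_mono) auto
    finally obtain x where x: "x \<noteq> 0" "\<And>y. y \<in> span ?V \<Longrightarrow> orthogonal x y"
      using orthogonal_to_subspace_exists[of ?V] by (metis DIM_cart DIM_real mult.right_neutral)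
    have orth: "b i \<bullet> (S *v x) = 0" "x \<bullet> (S *v b i) = 0" if "i \<in> J" for i
    proof -
      show "x \<bullet> (S *v b i) = 0"
        using x(2)[OF span_base, of "S *v b i"] that by (auto simp: orthogonal_def)
      then show "b i \<bullet> (S *v x) = 0"
        by (simp add: inner_symmetric_mv[OF sym, of "b i"] inner_commute)
    qed
    define c where "c = x \<bullet> (S *v x)"
    have c: "0 < c" using pos[OF x(1)] by (simp add: c_def)
    define b' where "b' = b(k := (1 / sqrt c) *\<^sub>R x)"
    have "b' i \<bullet> (S *v b' j) = (if i = j then 1 else 0)" if ij: "i \<in> insert k J" "j \<in> insert k J" for i j
    proof -
      have "(1 / sqrt c) * ((1 / sqrt c) * c) = 1"
        using c by (simp add: field_simps)
      then show ?thesis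
        using ij b orth insert.hyps(2)
        by (auto simp: b'_def matrix_vector_mult_scaleR c_def[symmetric])
    qed
    then show ?case by blast
  qed
  from this[of UNIV] show ?thesis by simp
qed

text \<open>
  If the columns of \<open>P\<close> are orthonormal for \<open>S\<close>, then \<open>P\<^sup>T S P = 1\<close>, and \<open>L = S P\<close> is the wanted factor
  since \<open>S P P\<^sup>T = 1\<close> as well.
\<close>

lemma pos_def_factorization:
  fixes S :: "real^'n^'n"
  assumes S: "pos_def S"
  obtains L where "S = L ** transpose L" "det L \<noteq> 0" "det S = (det L)\<^sup>2"
proof -
  have sym: "transpose S = S"
    using S by (auto simp: pos_def_def)
  obtain b :: "'n \<Rightarrow> real^'n" where b: "\<And>i j. b i \<bullet> (S *v b j) = (if i = j then 1 else 0)"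
    using exists_orthonormal_family[OF S] by blast
  define P where "P = (\<chi> r i. b i $ r)"
  have P: "P *v axis i 1 = b i" for i
    by (simp add: matrix_vector_mult_basis column_def P_def vec_eq_iff)
  have entry: "M $ i $ j = axis i 1 \<bullet> (M *v axis j 1)" for M :: "real^'n^'n" and i j
    by (simp add: matrix_vector_mult_basis column_def inner_axis')
  have "transpose P ** (S ** P) = mat 1"
  proof -
    have "(transpose P ** (S ** P)) $ i $ j = mat 1 $ i $ j" for i j
      unfolding entry[of "transpose P ** (S ** P)"]
      by (simp add: matrix_vector_mul_assoc[symmetric] inner_vm P b mat_def)
    then show ?thesis by (simp add: vec_eq_iff)
  qed
  then have 1: "(S ** P) ** transpose P = mat 1"
    using matrix_left_right_inverse by blast
  define L where "L = S ** P"
  have "S = L ** transpose L"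
    using 1 by (simp add: L_def matrix_transpose_mul sym matrix_mul_assoc)
  moreover from this have d: "det S = (det L)\<^sup>2"
    by (metis det_mul det_transpose power2_eq_square)
  moreover have "det L \<noteq> 0"
    using pos_def_det_pos[OF S] d by auto
  ultimately show ?thesis using that by blast
qed

lemma matrix_inv_mult:
  fixes S :: "real^'n^'n"
  assumes "det S \<noteq> 0"
  shows "S ** matrix_inv S = mat 1" "matrix_inv S ** S = mat 1"
proof -
  have "\<exists>N. S ** N = mat 1 \<and> N ** S = mat 1"
    using assms by (simp add: invertible_det_nz[symmetric] invertible_def)
  from someI_ex[OF this] show "S ** matrix_inv S = mat 1" "matrix_inv S ** S = mat 1"
    by (auto simp: matrix_inv_def)
qed

lemma matrix_inv_eqI:
  fixes S :: "real^'n^'n"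
  assumes "S ** N = mat 1"
  shows "matrix_inv S = N"
proof -
  have "det S * det N = 1"
    using assms by (metis det_I det_mul)
  then have "det S \<noteq> 0" by auto
  from matrix_inv_mult(2)[OF this] have "matrix_inv S ** (S ** N) = N"
    by (simp add: matrix_mul_assoc)
  then show ?thesis using assms by simp
qed

lemma inverse_quadratic_form_factored:
  fixes S L :: "real^'n^'n"
  assumes "S = L ** transpose L" "det L \<noteq> 0"
  shows "(L *v z) \<bullet> (matrix_inv S *v (L *v z)) = z \<bullet> z"
proof -
  have "det S \<noteq> 0" using assms by (simp add: det_mul)
  then have "(matrix_inv S ** L) ** transpose L = mat 1"
    using matrix_inv_mult(2)[of S] by (simp add: assms(1) matrix_mul_assoc)
  then have 1: "transpose L ** (matrix_inv S ** L) = mat 1"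
    using matrix_left_right_inverse by blast
  have "(L *v z) \<bullet> (matrix_inv S *v (L *v z)) = z \<bullet> ((transpose L ** (matrix_inv S ** L)) *v z)"
    by (simp add: matrix_vector_mul_assoc[symmetric] inner_vm)
  then show ?thesis by (simp add: 1)
qed

lemma borel_measurable_mv [measurable]:
  fixes L :: "real^'n^'m"
  shows "(\<lambda>x. L *v x) \<in> borel_measurable borel"
  by (intro borel_measurable_continuous_onI matrix_vector_mult_linear_continuous_on)

lemma borel_measurable_gaussian_density [measurable]:
  fixes S :: "real^'n^'n"
  shows "gaussian_density S \<in> borel_measurable borel"
  unfolding gaussian_density_def[abs_def] by measurable

lemma space_gaussian [simp]: "space (gaussian S) = UNIV"
  and sets_gaussian [measurable_cong, simp]: "sets (gaussian S) = sets borel"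
  by (simp_all add: gaussian_def)

text \<open>
  The exponent of the density of \<open>S\<close> at \<open>L z\<close> is that of the standard Gaussian at \<open>z\<close>, and the
  Jacobian \<open>\<bar>det L\<bar>\<close> turns one normalizing constant into the other because \<open>det S = (det L)\<^sup>2\<close>.
\<close>

lemma gaussian_eq_distr:
  fixes S L :: "real^'n^'n"
  assumes "S = L ** transpose L" "det L \<noteq> 0"
  shows "gaussian S = distr (gaussian (mat 1)) borel (\<lambda>z. L *v z)"
proof (rule measure_eqI)
  show "sets (gaussian S) = sets (distr (gaussian (mat 1)) borel (\<lambda>z. L *v z))" by simp
  have dS: "det S = (det L)\<^sup>2"
    by (simp add: assms(1) det_mul power2_eq_square)
  have "matrix_inv (mat 1 :: real^'n^'n) = mat 1"
    by (rule matrix_inv_eqI) simp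
  then have dens: "\<bar>det L\<bar> * gaussian_density S (L *v z) = gaussian_density (mat 1) z" for z
    using assms(2) by (simp add: gaussian_density_def inverse_quadratic_form_factored[OF assms] dS real_sqrt_mult)
  fix A assume "A \<in> sets (gaussian S)"
  then have [measurable]: "A \<in> sets borel" by simp
  have [measurable]: "(\<lambda>z. L *v z) -` A \<in> sets borel"
    by (rule measurable_sets_borel[OF borel_measurable_mv]) fact
  have "emeasure (gaussian S) A = (\<integral>\<^sup>+x. ennreal (gaussian_density S x) * indicator A x \<partial>lborel)"
    by (simp add: gaussian_def emeasure_density)
  also have "\<dots> = ennreal \<bar>det L\<bar> * (\<integral>\<^sup>+z. ennreal (gaussian_density S (L *v z)) * indicator A (L *v z) \<partial>lborel)"
    by (rule nn_integral_lborel_matrix[OF _ assms(2)]) measurable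
  also have "\<dots> = (\<integral>\<^sup>+z. ennreal (gaussian_density (mat 1) z) * indicator ((\<lambda>z. L *v z) -` A) z \<partial>lborel)"
    by (subst nn_integral_cmult[symmetric], measurable)
       (simp add: mult.assoc[symmetric] ennreal_mult'[symmetric] dens indicator_vimage[symmetric])
  also have "\<dots> = emeasure (gaussian (mat 1)) ((\<lambda>z. L *v z) -` A)"
    by (simp add: gaussian_def emeasure_density)
  also have "\<dots> = emeasure (distr (gaussian (mat 1)) borel (\<lambda>z. L *v z)) A"
    by (simp add: emeasure_distr)
  finally show "emeasure (gaussian S) A = emeasure (distr (gaussian (mat 1)) borel (\<lambda>z. L *v z)) A" .
qed

section \<open>Moments of Gaussian measures\<close>

lemma gaussian_std_density:
  "gaussian_density (mat 1 :: real^'n^'n) x = (\<Prod>i\<in>UNIV. std_normal_density (x $ i))"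
proof -
  have "matrix_inv (mat 1 :: real^'n^'n) = mat 1"
    by (rule matrix_inv_eqI) simp
  moreover have "- (x \<bullet> x) / 2 = (\<Sum>i\<in>UNIV. - (x $ i)\<^sup>2 / 2)"
    by (simp add: inner_vec_def power2_eq_square sum_divide_distrib sum_negf)
  moreover have "sqrt ((2 * pi) ^ CARD('n)) = sqrt (2 * pi) ^ CARD('n)"
    by (rule real_sqrt_power)
  ultimately show ?thesis
    by (simp add: gaussian_density_def std_normal_density_def exp_sum prod.distrib power_one_over prod_dividef)
qed

text \<open>
  The standard Gaussian density is the product of the one-dimensional ones, so integrals of
  products of functions of single coordinates factor. All moments below are instances.
\<close>

lemma has_bochner_integral_gaussian_std_prod:
  fixes f :: "'n::finite \<Rightarrow> real \<Rightarrow> real"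
  assumes f: "\<And>i. has_bochner_integral lborel (\<lambda>t. std_normal_density t * f i t) (c i)"
    and [measurable]: "\<And>i. f i \<in> borel_measurable borel"
  shows "has_bochner_integral (gaussian (mat 1)) (\<lambda>x::real^'n. \<Prod>i\<in>UNIV. f i (x $ i)) (\<Prod>i\<in>UNIV. c i)"
proof -
  interpret product_sigma_finite "\<lambda>_::real^'n. lborel :: real measure"
    by standard
  define h where "h = (\<lambda>(b::real^'n) t. std_normal_density t * f (axis_index b) t)"
  define \<Sigma> where "\<Sigma> = (\<lambda>f. \<Sum>b\<in>(Basis :: (real^'n) set). f b *\<^sub>R b)"
  have [measurable]: "\<Sigma> \<in> PiM Basis (\<lambda>_. lborel) \<rightarrow>\<^sub>M borel"
    unfolding \<Sigma>_def by measurable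
  have inj: "inj (\<lambda>i. axis i 1 :: real^'n)"
    by (auto simp: inj_def axis_eq_axis)
  have comp: "\<Sigma> g $ i = g (axis i 1)" for g i
    unfolding \<Sigma>_def Basis_cart_eq sum.reindex[OF inj]
    by (simp add: axis_nth_eq if_distrib cong: if_cong)
  have eq: "gaussian_density (mat 1) (\<Sigma> g) *\<^sub>R (\<Prod>i\<in>UNIV. f i (\<Sigma> g $ i)) = (\<Prod>b\<in>Basis. h b (g b))" for g
    unfolding Basis_cart_eq prod.reindex[OF inj]
    by (simp add: gaussian_std_density comp h_def prod.distrib)
  have h: "has_bochner_integral lborel (h b) (c (axis_index b))" for b
    unfolding h_def by (rule f)
  have "integrable (PiM Basis (\<lambda>_. lborel)) (\<lambda>g. \<Prod>b\<in>Basis. h b (g b))"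
    using h by (intro product_integrable_prod) (auto simp: has_bochner_integral_iff)
  moreover have "(\<integral>g. (\<Prod>b\<in>Basis. h b (g b)) \<partial>PiM Basis (\<lambda>_. lborel)) = (\<Prod>b\<in>(Basis::(real^'n) set). c (axis_index b))"
    using h by (subst product_integral_prod) (auto simp: has_bochner_integral_iff)
  moreover have "(\<Prod>b\<in>(Basis::(real^'n) set). c (axis_index b)) = (\<Prod>i\<in>UNIV. c i)"
    unfolding Basis_cart_eq prod.reindex[OF inj] by simp
  ultimately have P: "has_bochner_integral (PiM Basis (\<lambda>_. lborel)) (\<lambda>g. \<Prod>b\<in>(Basis::(real^'n) set). h b (g b)) (\<Prod>i\<in>UNIV. c i)"
    by (simp add: has_bochner_integral_iff)
  have [measurable]: "(\<lambda>x::real^'n. \<Prod>i\<in>UNIV. f i (x $ i)) \<in> borel_measurable borel"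
    by measurable
  have nn: "AE x in lborel. 0 \<le> gaussian_density (mat 1 :: real^'n^'n) x"
    by (intro AE_I2) (simp add: gaussian_std_density prod_nonneg)
  have l: "lborel = distr (PiM Basis (\<lambda>_. lborel)) borel \<Sigma>"
    unfolding \<Sigma>_def by (rule lborel_eq)
  show ?thesis
    using P nn unfolding has_bochner_integral_iff gaussian_def
    by (subst integrable_density integral_density; simp)+
       (simp add: l integrable_distr_eq integral_distr eq[unfolded real_scaleR_def])
qed

lemma std_normal_moments:
  "has_bochner_integral lborel (\<lambda>t. std_normal_density t * 1) 1"
  "has_bochner_integral lborel (\<lambda>t. std_normal_density t * t) 0"
  "has_bochner_integral lborel (\<lambda>t. std_normal_density t * (t * t)) 1"
  using std_normal_moment_even[of 0] std_normal_moment_odd[of 0] std_normal_moment_even[of 1]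
  by (simp_all add: power2_eq_square)

lemma gaussian_std_moments:
  fixes i j :: "'n::finite"
  shows "has_bochner_integral (gaussian (mat 1 :: real^'n^'n)) (\<lambda>x. 1) (1::real)"
    and "has_bochner_integral (gaussian (mat 1 :: real^'n^'n)) (\<lambda>x. x $ i) 0"
    and "has_bochner_integral (gaussian (mat 1 :: real^'n^'n)) (\<lambda>x. x $ i * x $ j) (if i = j then 1 else 0)"
proof -
  show "has_bochner_integral (gaussian (mat 1 :: real^'n^'n)) (\<lambda>x. 1) (1::real)"
    using has_bochner_integral_gaussian_std_prod[of "\<lambda>(_::'n) _. 1" "\<lambda>_. 1"] std_normal_moments by simp
  have "has_bochner_integral (gaussian (mat 1 :: real^'n^'n))
      (\<lambda>x. \<Prod>k\<in>UNIV. if k = i then x $ k else 1) (\<Prod>k\<in>UNIV. if k = i then 0 else 1)"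
    by (rule has_bochner_integral_gaussian_std_prod[of "\<lambda>k t. if k = i then t else 1"])
       (use std_normal_moments in auto)
  then show "has_bochner_integral (gaussian (mat 1 :: real^'n^'n)) (\<lambda>x. x $ i) 0"
    by simp
  have "has_bochner_integral (gaussian (mat 1 :: real^'n^'n))
      (\<lambda>x. \<Prod>k\<in>UNIV. (if k = i then x $ k else 1) * (if k = j then x $ k else 1))
      (\<Prod>k\<in>UNIV. if k = i then (if i = j then 1 else 0) else if k = j then 0 else 1)"
    by (rule has_bochner_integral_gaussian_std_prod[of "\<lambda>k t. (if k = i then t else 1) * (if k = j then t else 1)"])
       (use std_normal_moments in auto)
  moreover have "(\<Prod>k\<in>UNIV. if k = i then (if i = j then 1 else 0) else if k = j then 0 else 1) = (if i = j then 1 else (0::real))"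
  proof (cases "i = j")
    case True
    then show ?thesis by (auto intro!: prod.neutral)
  next
    case False
    then show ?thesis by (auto intro!: prod_zero bexI[of _ i])
  qed
  ultimately show "has_bochner_integral (gaussian (mat 1 :: real^'n^'n)) (\<lambda>x. x $ i * x $ j) (if i = j then 1 else 0)"
    by (simp add: prod.distrib)
qed

lemma gaussian_std_inner:
  fixes a b :: "real^'n"
  shows "has_bochner_integral (gaussian (mat 1)) (\<lambda>x. a \<bullet> x) 0"
    and "has_bochner_integral (gaussian (mat 1)) (\<lambda>x. (a \<bullet> x) * (b \<bullet> x)) (a \<bullet> b)"
proof -
  have "has_bochner_integral (gaussian (mat 1)) (\<lambda>x. \<Sum>i\<in>UNIV. a $ i * x $ i) (\<Sum>i\<in>UNIV. a $ i * 0)"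
    by (intro has_bochner_integral_sum has_bochner_integral_mult_right gaussian_std_moments)
  then show "has_bochner_integral (gaussian (mat 1)) (\<lambda>x. a \<bullet> x) 0"
    by (simp add: inner_vec_def)
  have "has_bochner_integral (gaussian (mat 1)) (\<lambda>x. \<Sum>i\<in>UNIV. \<Sum>j\<in>UNIV. a $ i * b $ j * (x $ i * x $ j))
      (\<Sum>i\<in>UNIV. \<Sum>j\<in>UNIV. a $ i * b $ j * (if i = j then 1 else 0))"
    by (intro has_bochner_integral_sum has_bochner_integral_mult_right gaussian_std_moments)
  then show "has_bochner_integral (gaussian (mat 1)) (\<lambda>x. (a \<bullet> x) * (b \<bullet> x)) (a \<bullet> b)"
    by (simp add: inner_vec_def sum_product if_distrib mult_ac cong: if_cong)
qed

lemma prob_space_gaussian: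
  fixes S :: "real^'n^'n"
  assumes S: "pos_def S"
  shows "prob_space (gaussian S)"
proof -
  obtain L where L: "S = L ** transpose L" "det L \<noteq> 0"
    using pos_def_factorization[OF S] .
  have one: "integrable (gaussian (mat 1 :: real^'n^'n)) (\<lambda>x. 1 :: real)"
    "(\<integral>x. 1 \<partial>gaussian (mat 1 :: real^'n^'n)) = (1 :: real)"
    using gaussian_std_moments(1) unfolding has_bochner_integral_iff by blast+
  have "(\<integral>\<^sup>+x. ennreal 1 \<partial>gaussian (mat 1 :: real^'n^'n)) = ennreal (\<integral>x. 1 \<partial>gaussian (mat 1 :: real^'n^'n))"
    by (rule nn_integral_eq_integral) (use one in auto)
  then have "emeasure (gaussian (mat 1 :: real^'n^'n)) UNIV = 1"
    unfolding one(2) by simp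
  then have "prob_space (gaussian (mat 1 :: real^'n^'n))"
    by (intro prob_spaceI) simp
  then show ?thesis
    unfolding gaussian_eq_distr[OF L] by (rule prob_space.prob_space_distr) simp
qed

lemma gaussian_moments:
  fixes S :: "real^'n^'n"
  assumes S: "pos_def S"
  shows "has_bochner_integral (gaussian S) (\<lambda>x. a \<bullet> x) 0"
    and "has_bochner_integral (gaussian S) (\<lambda>x. (a \<bullet> x) * (b \<bullet> x)) (a \<bullet> (S *v b))"
proof -
  obtain L where L: "S = L ** transpose L" "det L \<noteq> 0"
    using pos_def_factorization[OF S] .
  have S': "has_bochner_integral (gaussian S) f c \<longleftrightarrow> has_bochner_integral (gaussian (mat 1)) (\<lambda>z. f (L *v z)) c"
    if [measurable]: "f \<in> borel_measurable borel" for f :: "real^'n \<Rightarrow> real" and c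
    unfolding gaussian_eq_distr[OF L] has_bochner_integral_iff
    by (simp add: integrable_distr_eq integral_distr)
  have adj: "a \<bullet> (L *v z) = (a v* L) \<bullet> z" for a z
    by (rule dot_lmul_matrix[symmetric])
  show "has_bochner_integral (gaussian S) (\<lambda>x. a \<bullet> x) 0"
    by (subst S', measurable) (simp add: adj gaussian_std_inner)
  have "a \<bullet> (S *v b) = (a v* L) \<bullet> (b v* L)"
    by (simp add: L(1) matrix_vector_mul_assoc[symmetric] adj)
  then show "has_bochner_integral (gaussian S) (\<lambda>x. (a \<bullet> x) * (b \<bullet> x)) (a \<bullet> (S *v b))"
    by (subst S', measurable) (simp add: adj gaussian_std_inner)
qed

text \<open>
  The expected value of \<open>x \<bullet> M x\<close> is the trace of \<open>M S\<^sup>T\<close>, written as the inner product of matrices.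
\<close>

lemma gaussian_quadratic_form:
  fixes S M :: "real^'n^'n"
  assumes S: "pos_def S"
  shows "has_bochner_integral (gaussian S) (\<lambda>x. x \<bullet> (M *v x)) (M \<bullet> S)"
proof -
  have "has_bochner_integral (gaussian S) (\<lambda>x. \<Sum>i\<in>UNIV. (axis i 1 \<bullet> x) * (M $ i \<bullet> x))
      (\<Sum>i\<in>UNIV. axis i 1 \<bullet> (S *v (M $ i)))"
    by (intro has_bochner_integral_sum gaussian_moments S)
  moreover have "(\<Sum>i\<in>UNIV. (axis i 1 \<bullet> x) * (M $ i \<bullet> x)) = x \<bullet> (M *v x)" for x
    by (simp add: inner_vec_def[of x] inner_axis' matrix_vector_mul_component)
  moreover have "(\<Sum>i\<in>UNIV. axis i 1 \<bullet> (S *v (M $ i))) = M \<bullet> S"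
    by (simp add: inner_vec_def[of M] inner_axis' matrix_vector_mul_component inner_commute)
  ultimately show ?thesis by simp
qed

section \<open>Kullback-Leibler balls of Gaussian covariances\<close>

lemma has_bochner_integral_prob_const:
  fixes c :: real
  assumes "prob_space M"
  shows "has_bochner_integral M (\<lambda>_. c) c"
proof -
  interpret prob_space M by fact
  show ?thesis using prob_space by (simp add: has_bochner_integral_iff)
qed

lemma matrix_inv_inner_self:
  fixes S :: "real^'n^'n"
  assumes S: "pos_def S"
  shows "matrix_inv S \<bullet> S = CARD('n)"
proof -
  have sym: "S $ i $ j = S $ j $ i" for i j
  proof -
    have "transpose S $ j $ i = S $ j $ i"
      using S by (simp add: pos_def_def)
    then show ?thesis by (simp add: transpose_def)
  qed
  have "matrix_inv S ** S = mat 1"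
    using pos_def_det_pos[OF S] by (intro matrix_inv_mult) simp
  then have "(matrix_inv S ** S) $ i $ i = 1" for i
    by (simp add: mat_def)
  then have row: "(\<Sum>j\<in>UNIV. matrix_inv S $ i $ j * S $ j $ i) = 1" for i
    by (simp add: matrix_matrix_mult_def)
  have "matrix_inv S \<bullet> S = (\<Sum>i\<in>UNIV. \<Sum>j\<in>UNIV. matrix_inv S $ i $ j * S $ j $ i)"
    unfolding inner_vec_def inner_real_def by (intro sum.cong refl) (subst sym, rule refl)
  then show ?thesis by (simp add: row)
qed

lemma ln_gaussian_density_ratio:
  fixes S S0 :: "real^'n^'n"
  assumes "pos_def S0" "pos_def S"
  shows "ln (gaussian_density S x / gaussian_density S0 x) =
    (x \<bullet> (matrix_inv S0 *v x) - x \<bullet> (matrix_inv S *v x) + (ln (det S0) - ln (det S))) / 2"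
proof -
  have l: "ln (gaussian_density U x) = - (x \<bullet> (matrix_inv U *v x)) / 2 - (ln ((2 * pi) ^ CARD('n)) + ln (det U)) / 2"
    if "pos_def U" for U :: "real^'n^'n"
    using pos_def_det_pos[OF that]
    by (simp add: gaussian_density_def ln_div ln_sqrt ln_mult)
  show ?thesis
    using gaussian_density_pos[OF assms(1), of x] gaussian_density_pos[OF assms(2), of x]
    by (simp add: ln_div l[OF assms(1)] l[OF assms(2)] field_simps)
qed

lemma gaussian_log_ratio_integral:
  fixes S S0 :: "real^'n^'n"
  assumes "pos_def S0" "pos_def S"
  shows "has_bochner_integral lborel
      (\<lambda>x. gaussian_density S x * ln (gaussian_density S x / gaussian_density S0 x))
      ((matrix_inv S0 \<bullet> S - CARD('n) + ln (det S0) - ln (det S)) / 2)"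
proof -
  note const = has_bochner_integral_prob_const[OF prob_space_gaussian[OF assms(2)]]
  have "has_bochner_integral (gaussian S) (\<lambda>x. (x \<bullet> (matrix_inv S0 *v x) - x \<bullet> (matrix_inv S *v x) + (ln (det S0) - ln (det S))) / 2)
     ((matrix_inv S0 \<bullet> S - matrix_inv S \<bullet> S + (ln (det S0) - ln (det S))) / 2)"
    by (intro has_bochner_integral_divide has_bochner_integral_add has_bochner_integral_diff
        gaussian_quadratic_form assms const)
  then have "has_bochner_integral (gaussian S) (\<lambda>x. ln (gaussian_density S x / gaussian_density S0 x))
     ((matrix_inv S0 \<bullet> S - CARD('n) + ln (det S0) - ln (det S)) / 2)"
    by (simp add: ln_gaussian_density_ratio[OF assms] matrix_inv_inner_self[OF assms(2)] algebra_simps)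
  moreover have "AE x in lborel. 0 \<le> gaussian_density S x"
    using gaussian_density_pos[OF assms(2)] by (intro AE_I2) (simp add: less_imp_le)
  ultimately show ?thesis
    unfolding has_bochner_integral_iff gaussian_def
    by (simp add: integrable_density integral_density)
qed

text \<open>
  The trace term of the second argument is \<open>n\<close> by \<open>matrix_inv_inner_self\<close>; what remains of it is
  the logarithm of the determinant.
\<close>

lemma KL_divergence_gaussian_eq:
  fixes S S0 :: "real^'n^'n"
  assumes "pos_def S0" "pos_def S"
  shows "KL_divergence (exp 1) (gaussian S0) (gaussian S) =
    (matrix_inv S0 \<bullet> S - CARD('n) + ln (det S0) - ln (det S)) / 2"
  using KL_divergence_gaussian[OF assms] gaussian_log_ratio_integral[OF assms]
  by (simp add: has_bochner_integral_iff)

text \<open>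
  Gibbs' inequality, that is, nonnegativity of the divergence. The right-hand side is affine in \<open>S\<close>,
  and equality holds at \<open>S = S0\<close>.
\<close>

lemma ln_det_le:
  fixes S S0 :: "real^'n^'n"
  assumes "pos_def S0" "pos_def S"
  shows "ln (det S) \<le> matrix_inv S0 \<bullet> S - CARD('n) + ln (det S0)"
proof -
  have "0 \<le> KL_divergence (exp 1) (gaussian S0) (gaussian S)"
    unfolding gaussian_def
  proof (rule lborel.KL_density_density_nonneg)
    show "prob_space (density lborel (\<lambda>x. ennreal (gaussian_density S0 x)))"
      "prob_space (density lborel (\<lambda>x. ennreal (gaussian_density S x)))"
      using prob_space_gaussian assms by (auto simp: gaussian_def)
    show "AE x in lborel. 0 \<le> gaussian_density S0 x" "AE x in lborel. 0 \<le> gaussian_density S x"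
      using gaussian_density_pos assms by (auto intro!: AE_I2 less_imp_le)
    show "AE x in lborel. gaussian_density S0 x = 0 \<longrightarrow> gaussian_density S x = 0"
      using gaussian_density_pos[OF assms(1)] by (intro AE_I2) (metis less_irrefl)
    show "integrable lborel (\<lambda>x. gaussian_density S x * log (exp 1) (gaussian_density S x / gaussian_density S0 x))"
      using gaussian_log_ratio_integral[OF assms] by (simp add: has_bochner_integral_iff log_def)
  qed simp_all
  then show ?thesis
    by (simp add: KL_divergence_gaussian_eq[OF assms])
qed

text \<open>
  The left-hand side of the inequality is twice the divergence from the nominal Gaussian.
\<close>

definition covariance_ball :: "real \<Rightarrow> real^'n^'n \<Rightarrow> (real^'n^'n) set" where
  "covariance_ball \<rho> S0 =
     {S. pos_def S \<and> matrix_inv S0 \<bullet> S - CARD('n) + ln (det S0) - ln (det S) \<le> 2 * \<rho>}"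

lemma gaussian_ball_eq:
  assumes "pos_def S0"
  shows "gaussian_ball \<rho> S0 = gaussian ` covariance_ball \<rho> S0"
proof -
  have "KL_divergence (exp 1) (gaussian S0) (gaussian S) \<le> \<rho> \<longleftrightarrow>
      matrix_inv S0 \<bullet> S - CARD('a) + ln (det S0) - ln (det S) \<le> 2 * \<rho>" if "pos_def S" for S
    unfolding KL_divergence_gaussian_eq[OF assms that] by (subst pos_divide_le_eq) (simp_all add: mult.commute)
  then show ?thesis
    unfolding gaussian_ball_def covariance_ball_def by blast
qed

lemma mv_scaleR_add:
  fixes M N :: "real^'n^'m"
  shows "(a *\<^sub>R M + b *\<^sub>R N) *v x = a *\<^sub>R (M *v x) + b *\<^sub>R (N *v x)"
  by (simp add: matrix_vector_mult_add_rdistrib flip: scaleR_matrix_vector_assoc)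

lemma pos_def_convex_combination:
  assumes "pos_def S1" "pos_def S2" "0 \<le> a" "0 \<le> b" "a + b = (1::real)"
  shows "pos_def (a *\<^sub>R S1 + b *\<^sub>R S2)"
  unfolding pos_def_def
proof (intro conjI allI impI)
  show "transpose (a *\<^sub>R S1 + b *\<^sub>R S2) = a *\<^sub>R S1 + b *\<^sub>R S2"
    using assms(1,2) by (auto simp: pos_def_def transpose_def vec_eq_iff)
  fix x :: "real^'a" assume x: "x \<noteq> 0"
  have "0 < x \<bullet> (S1 *v x)" "0 < x \<bullet> (S2 *v x)"
    using assms x by (auto simp: pos_def_def)
  then have "0 < a * (x \<bullet> (S1 *v x)) + b * (x \<bullet> (S2 *v x))"
    using assms(3-5) by (cases "a = 0") (auto intro: add_pos_nonneg)
  then show "0 < x \<bullet> ((a *\<^sub>R S1 + b *\<^sub>R S2) *v x)"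
    by (simp add: mv_scaleR_add inner_add_right)
qed

text \<open>
  At the mixture \<open>S\<close>, the affine majorant of \<open>ln det\<close> with reference \<open>S\<close> is exact, whereas at
  \<open>S1\<close> and \<open>S2\<close> it is an upper bound.
\<close>

lemma ln_det_concave:
  fixes S1 S2 :: "real^'n^'n"
  assumes S: "pos_def S1" "pos_def S2" and ab: "0 \<le> a" "0 \<le> b" "a + b = 1"
  shows "a * ln (det S1) + b * ln (det S2) \<le> ln (det (a *\<^sub>R S1 + b *\<^sub>R S2))"
proof -
  define S where "S = a *\<^sub>R S1 + b *\<^sub>R S2"
  let ?N = "matrix_inv S"
  have pd: "pos_def S"
    unfolding S_def using assms by (rule pos_def_convex_combination)
  have "a * ln (det S1) + b * ln (det S2) \<le>
      a * (?N \<bullet> S1 - CARD('n) + ln (det S)) + b * (?N \<bullet> S2 - CARD('n) + ln (det S))"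
    using ab ln_det_le[OF pd] S by (intro add_mono mult_left_mono)
  also have "\<dots> = ?N \<bullet> S + (a + b) * (ln (det S) - CARD('n))"
    by (simp add: S_def inner_add_right algebra_simps)
  also have "\<dots> = ln (det S)"
    by (simp add: ab matrix_inv_inner_self[OF pd])
  finally show ?thesis by (simp add: S_def)
qed

lemma convex_covariance_ball: "convex (covariance_ball \<rho> S0)"
proof (rule convexI)
  fix S1 S2 and a b :: real
  assume S: "S1 \<in> covariance_ball \<rho> S0" "S2 \<in> covariance_ball \<rho> S0" and ab: "0 \<le> a" "0 \<le> b" "a + b = 1"
  let ?S = "a *\<^sub>R S1 + b *\<^sub>R S2" and ?N = "matrix_inv S0" and ?c = "ln (det S0) - CARD('a)"
  have pd: "pos_def S1" "pos_def S2"
    using S by (auto simp: covariance_ball_def)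
  have "a * (?N \<bullet> S1 + ?c - ln (det S1)) + b * (?N \<bullet> S2 + ?c - ln (det S2)) \<le> a * (2 * \<rho>) + b * (2 * \<rho>)"
    using S ab by (intro add_mono mult_left_mono) (auto simp: covariance_ball_def)
  also have "\<dots> = 2 * \<rho>" by (simp add: ab(3) flip: distrib_right)
  finally have "?N \<bullet> ?S + (a + b) * ?c - (a * ln (det S1) + b * ln (det S2)) \<le> 2 * \<rho>"
    by (simp add: inner_add_right algebra_simps)
  with ln_det_concave[OF pd ab] have "?N \<bullet> ?S - CARD('a) + ln (det S0) - ln (det ?S) \<le> 2 * \<rho>"
    by (simp add: ab(3))
  then show "?S \<in> covariance_ball \<rho> S0"
    using pos_def_convex_combination[OF pd ab] by (simp add: covariance_ball_def)
qed

text \<open>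
  If \<open>x \<bullet> S x = 0\<close> with \<open>x \<noteq> 0\<close>, then \<open>S x \<noteq> 0\<close>, and moving from \<open>x\<close> a little in the direction
  \<open>- S x\<close> would make the quadratic form negative.
\<close>

lemma pos_def_if_psd_det_nonzero:
  fixes S :: "real^'n^'n"
  assumes psd: "psd S" and det: "det S \<noteq> 0"
  shows "pos_def S"
  unfolding pos_def_def
proof (intro conjI allI impI)
  show sym: "transpose S = S" using psd by (simp add: psd_def)
  have nn: "0 \<le> x \<bullet> (S *v x)" for x using psd by (simp add: psd_def)
  fix x :: "real^'n" assume x: "x \<noteq> 0"
  define y where "y = S *v x"
  have "y \<noteq> 0"
    using x matrix_inv_mult(2)[OF det] unfolding y_def
    by (metis matrix_vector_mul_assoc matrix_vector_mul_lid matrix_vector_mult_0_right)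
  then have yy: "0 < y \<bullet> y" by simp
  define q where "q = y \<bullet> (S *v y)"
  have q: "0 \<le> q" unfolding q_def by (rule nn)
  show "0 < x \<bullet> (S *v x)"
  proof (rule ccontr)
    assume "\<not> 0 < x \<bullet> (S *v x)"
    then have 0: "x \<bullet> (S *v x) = 0" using nn[of x] by linarith
    \<comment> \<open>This step is short enough for the linear decrease to beat the quadratic term; \<open>q + 1\<close> avoids a division by zero.\<close>
    define t where "t = (y \<bullet> y) / (q + 1)"
    have t: "0 < t" "t * q \<le> y \<bullet> y"
      using yy q by (auto simp: t_def field_simps)
    have "0 \<le> (x - t *\<^sub>R y) \<bullet> (S *v (x - t *\<^sub>R y))" by (rule nn)
    also have "\<dots> = t * (t * q - 2 * (y \<bullet> y))"
      using 0 by (simp add: matrix_vector_mult_diff_distrib matrix_vector_mult_scaleR inner_diff_left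
          inner_diff_right inner_symmetric_mv[OF sym, of x] q_def y_def[symmetric] algebra_simps)
    also have "\<dots> < 0"
      using t yy by (intro mult_pos_neg) linarith+
    finally show False by simp
  qed
qed

text \<open>
  With \<open>x = L z\<close>, the inverse form at \<open>x\<close> is \<open>z \<bullet> z\<close>, and \<open>L\<close> is a bounded operator.
\<close>

lemma inner_le_inverse_form:
  fixes S0 :: "real^'n^'n"
  assumes "pos_def S0"
  obtains c where "0 \<le> c" "\<And>x. x \<bullet> x \<le> c * (x \<bullet> (matrix_inv S0 *v x))"
proof -
  obtain L where L: "S0 = L ** transpose L" "det L \<noteq> 0"
    using pos_def_factorization[OF assms] .
  obtain B where B: "\<And>z. norm (L *v z) \<le> B * norm z"
    using linear_bounded[OF matrix_vector_mul_linear[of L]] by blast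
  have "x \<bullet> x \<le> B\<^sup>2 * (x \<bullet> (matrix_inv S0 *v x))" for x
  proof -
    define z where "z = matrix_inv L *v x"
    have x: "x = L *v z"
      by (simp add: z_def matrix_vector_mul_assoc matrix_inv_mult(1)[OF L(2)])
    have "x \<bullet> x = (norm (L *v z))\<^sup>2"
      by (simp add: x power2_norm_eq_inner)
    also have "\<dots> \<le> (B * norm z)\<^sup>2"
      using B by (intro power_mono) auto
    also have "\<dots> = B\<^sup>2 * (x \<bullet> (matrix_inv S0 *v x))"
      by (simp add: x inverse_quadratic_form_factored[OF L] power_mult_distrib power2_norm_eq_inner)
    finally show ?thesis .
  qed
  then show ?thesis using that[of "B\<^sup>2"] by simp
qed

text \<open>
  Gibbs' inequality with reference \<open>2 S0\<close> bounds \<open>ln det S\<close> by half of \<open>S0\<^sup>-\<^sup>1 \<bullet> S\<close> plus a constant, so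
  a bound on the divergence bounds the other half of that trace. The trace is the expectation of
  \<open>x \<bullet> S0\<^sup>-\<^sup>1 x\<close>, which dominates the second moments, and these are the entries of \<open>S\<close>.
\<close>

lemma bounded_covariance_ball:
  fixes S0 :: "real^'n^'n"
  assumes S0: "pos_def S0"
  shows "bounded (covariance_ball \<rho> S0)"
proof -
  let ?N = "matrix_inv S0"
  obtain c where c: "0 \<le> c" "\<And>x. x \<bullet> x \<le> c * (x \<bullet> (?N *v x))"
    using inner_le_inverse_form[OF S0] by blast
  \<comment> \<open>\<open>K\<close> bounds \<open>S0\<^sup>-\<^sup>1 \<bullet> S\<close>; half of that trace goes into the bound of \<open>ln det S\<close>, hence the leading factor.\<close>
  define K where "K = 2 * (2 * \<rho> - ln (det S0) + ln (det (2 *\<^sub>R S0)))"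
  have S0': "pos_def (2 *\<^sub>R S0)"
    using S0 by (auto simp: pos_def_def transpose_def vec_eq_iff simp flip: scaleR_matrix_vector_assoc)
  have "(2 *\<^sub>R S0) ** ((1/2) *\<^sub>R ?N) = S0 ** ?N"
    by (simp add: matrix_matrix_mult_def)
  also have "\<dots> = mat 1"
    using pos_def_det_pos[OF S0] by (intro matrix_inv_mult) simp
  finally have N2: "matrix_inv (2 *\<^sub>R S0) = (1/2) *\<^sub>R ?N"
    by (rule matrix_inv_eqI)
  have "norm S \<le> real CARD('n) * (real CARD('n) * (c * K))" if "S \<in> covariance_ball \<rho> S0" for S
  proof -
    have S: "pos_def S" and le: "?N \<bullet> S - CARD('n) + ln (det S0) - ln (det S) \<le> 2 * \<rho>"
      using that by (auto simp: covariance_ball_def)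
    have NS: "?N \<bullet> S \<le> K"
      using ln_det_le[OF S0' S] le by (simp add: N2 K_def)
    note m = gaussian_quadratic_form[OF S, of ?N] gaussian_quadratic_form[OF S, of "mat 1"]
    have "(\<integral>x. x \<bullet> x \<partial>gaussian S) \<le> (\<integral>x. c * (x \<bullet> (?N *v x)) \<partial>gaussian S)"
      using m c(2) by (intro integral_mono) (auto simp: has_bochner_integral_iff)
    also have "\<dots> = c * (?N \<bullet> S)"
      using m by (simp add: has_bochner_integral_iff)
    also have "\<dots> \<le> c * K" using NS c(1) by (rule mult_left_mono)
    finally have tr: "(\<integral>x. x \<bullet> x \<partial>gaussian S) \<le> c * K" .
    \<comment> \<open>Each entry is a mixed second moment, bounded by the expected squared norm.\<close>
    have entry: "\<bar>S $ i $ j\<bar> \<le> c * K" for i j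
    proof -
      have e: "has_bochner_integral (gaussian S) (\<lambda>x. x $ i * x $ j) (S $ i $ j)"
        using gaussian_moments(2)[OF S, of "axis i 1" "axis j 1"]
        by (simp add: inner_axis' matrix_vector_mult_basis column_def)
      have "\<bar>S $ i $ j\<bar> = \<bar>\<integral>x. x $ i * x $ j \<partial>gaussian S\<bar>"
        using e by (simp add: has_bochner_integral_iff)
      also have "\<dots> \<le> (\<integral>x. \<bar>x $ i * x $ j\<bar> \<partial>gaussian S)"
        by (rule integral_abs_bound)
      also have "\<dots> \<le> (\<integral>x. x \<bullet> x \<partial>gaussian S)"
      proof (rule integral_mono)
        show "integrable (gaussian S) (\<lambda>x. \<bar>x $ i * x $ j\<bar>)"
          using e by (simp add: has_bochner_integral_iff)
        show "integrable (gaussian S) (\<lambda>x. x \<bullet> x)"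
          using m(2) by (simp add: has_bochner_integral_iff)
        show "\<bar>x $ i * x $ j\<bar> \<le> x \<bullet> x" for x :: "real^'n"
          using mult_mono[OF component_le_norm_cart[of x i] component_le_norm_cart[of x j]]
          by (simp add: abs_mult power2_norm_eq_inner[symmetric] power2_eq_square)
      qed
      finally show ?thesis using tr by linarith
    qed
    have "norm S \<le> (\<Sum>i\<in>UNIV. norm (S $ i))"
      unfolding norm_vec_def by (intro L2_set_le_sum) auto
    also have "\<dots> \<le> (\<Sum>i\<in>(UNIV::'n set). \<Sum>j\<in>(UNIV::'n set). c * K)"
      by (intro sum_mono order_trans[OF norm_le_l1_cart] entry)
    finally show ?thesis by simp
  qed
  then show ?thesis by (auto simp: bounded_iff)
qed

lemma continuous_on_det: "continuous_on A (\<lambda>S::real^'n^'n. det S)"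
  unfolding det_def by (intro continuous_intros)

lemma closed_psd: "closed {S :: real^'n^'n. psd S}"
proof -
  have "{S :: real^'n^'n. psd S} = {S. (\<forall>i j. S $ j $ i = S $ i $ j) \<and>
      (\<forall>x. 0 \<le> (\<Sum>i\<in>UNIV. x $ i * (\<Sum>j\<in>UNIV. S $ i $ j * x $ j)))}"
    by (auto simp: psd_def transpose_def vec_eq_iff inner_vec_def matrix_vector_mult_def)
  also have "closed \<dots>"
    by (intro closed_Collect_conj closed_Collect_all closed_Collect_eq closed_Collect_le continuous_intros)
  finally show ?thesis .
qed

text \<open>
  Positive definiteness is not a closed condition. Exponentiating the bound on the divergence
  replaces it by closed ones: positive semidefiniteness together with a positive lower bound for the
  determinant.
\<close>

lemma compact_covariance_ball:
  fixes S0 :: "real^'n^'n"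
  assumes S0: "pos_def S0"
  shows "compact (covariance_ball \<rho> S0)"
proof -
  let ?e = "\<lambda>S. matrix_inv S0 \<bullet> S - CARD('n) + ln (det S0) - 2 * \<rho>"
  have eq: "covariance_ball \<rho> S0 = {S. psd S} \<inter> {S. exp (?e S) \<le> det S}"
  proof (intro equalityI subsetI)
    fix S assume "S \<in> covariance_ball \<rho> S0"
    then have S: "pos_def S" and "?e S \<le> ln (det S)"
      by (auto simp: covariance_ball_def)
    moreover have "psd S"
      unfolding psd_def using S by (metis inner_zero_left less_eq_real_def pos_def_def)
    ultimately show "S \<in> {S. psd S} \<inter> {S. exp (?e S) \<le> det S}"
      using pos_def_det_pos[OF S] by (auto simp: ln_ge_iff)
  next
    fix S assume "S \<in> {S. psd S} \<inter> {S. exp (?e S) \<le> det S}"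
    then have psd: "psd S" and e: "exp (?e S) \<le> det S" by auto
    have pos: "0 < det S" using e exp_gt_zero less_le_trans by blast
    then have "?e S \<le> ln (det S)" using e by (simp add: ln_ge_iff)
    then show "S \<in> covariance_ball \<rho> S0"
      using pos_def_if_psd_det_nonzero[OF psd] pos by (auto simp: covariance_ball_def)
  qed
  have "closed {S. exp (?e S) \<le> det S}"
    by (intro closed_Collect_le continuous_intros continuous_on_det)
  from closed_Int[OF closed_psd this] show ?thesis
    using bounded_covariance_ball[OF S0, of \<rho>] unfolding compact_eq_bounded_closed by (simp only: eq)
qed

section \<open>Expectations under independent Gaussian disturbances\<close>

lemma has_bochner_integral_pair_product:
  fixes f :: "'a \<Rightarrow> real" and g :: "'b \<Rightarrow> real"
  assumes "sigma_finite_measure P" "sigma_finite_measure Q"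
    and f: "has_bochner_integral P f c" and g: "has_bochner_integral Q g d"
  shows "has_bochner_integral (P \<Otimes>\<^sub>M Q) (\<lambda>(w, v). f w * g v) (c * d)"
proof -
  interpret P: sigma_finite_measure P by fact
  interpret Q: sigma_finite_measure Q by fact
  interpret pair_sigma_finite P Q ..
  have fi: "integrable P f" and gi: "integrable Q g" and eq: "integral\<^sup>L P f = c" "integral\<^sup>L Q g = d"
    using f g by (auto simp: has_bochner_integral_iff)
  have [measurable]: "f \<in> borel_measurable P" "g \<in> borel_measurable Q"
    using fi gi by auto
  have int: "integrable (P \<Otimes>\<^sub>M Q) (\<lambda>(w, v). f w * g v)"
    by (rule Fubini_integrable) (use fi gi in \<open>auto simp: abs_mult\<close>)
  moreover have "(\<integral>p. (case p of (w, v) \<Rightarrow> f w * g v) \<partial>(P \<Otimes>\<^sub>M Q)) = c * d"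
    using integral_fst'[OF int] by (simp add: eq)
  ultimately show ?thesis by (simp add: has_bochner_integral_iff)
qed

context
  fixes S :: "nat \<Rightarrow> real^'n^'n" and I :: "nat set"
  assumes S: "\<And>i. pos_def (S i)" and I: "finite I"
begin

lemma prob_space_gaussian_product: "prob_space (PiM I (\<lambda>i. gaussian (S i)))"
  by (intro prob_space_PiM prob_space_gaussian S)

lemma gaussian_product_component:
  fixes f :: "real^'n \<Rightarrow> real"
  assumes i: "i \<in> I" and f: "has_bochner_integral (gaussian (S i)) f c" "f \<in> borel_measurable borel"
  shows "has_bochner_integral (PiM I (\<lambda>i. gaussian (S i))) (\<lambda>w. f (w i)) c"
proof -
  have d: "distr (PiM I (\<lambda>i. gaussian (S i))) (gaussian (S i)) (\<lambda>w. w i) = gaussian (S i)"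
    by (rule distr_PiM_component) (use i I prob_space_gaussian S in auto)
  have m: "f \<in> borel_measurable (gaussian (S i))"
    using f(2) by simp
  have p: "(\<lambda>w. w i) \<in> PiM I (\<lambda>i. gaussian (S i)) \<rightarrow>\<^sub>M gaussian (S i)"
    by (rule measurable_component_singleton[OF i])
  show ?thesis
    using f(1) integrable_distr_eq[OF p m] integral_distr[OF p m] unfolding d
    by (simp add: has_bochner_integral_iff)
qed

text \<open>
  For distinct indices the integrand is a product over all coordinates whose factor at \<open>i\<close> has mean
  zero.
\<close>

lemma gaussian_product_cross:
  assumes ij: "i \<in> I" "j \<in> I"
  shows "has_bochner_integral (PiM I (\<lambda>i. gaussian (S i))) (\<lambda>w. (a \<bullet> w i) * (b \<bullet> w j))
    (if i = j then a \<bullet> (S i *v b) else 0)"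
proof (cases "i = j")
  case True
  then show ?thesis
    using gaussian_product_component[OF ij(1) gaussian_moments(2)[OF S]] by simp
next
  case False
  interpret product_prob_space "\<lambda>i. gaussian (S i)"
    by (intro product_prob_spaceI prob_space_gaussian S)
  interpret product_sigma_finite "\<lambda>i. gaussian (S i)" ..
  define f where "f = (\<lambda>k x. if k = i then a \<bullet> x else if k = j then b \<bullet> x else (1::real))"
  have m: "has_bochner_integral (gaussian (S k)) (f k) (if k = i \<or> k = j then 0 else 1)" for k
  proof -
    consider "f k = (\<lambda>x. a \<bullet> x)" "k = i" | "f k = (\<lambda>x. b \<bullet> x)" "k = j" | "f k = (\<lambda>x. 1)" "k \<noteq> i" "k \<noteq> j"
      by (cases "k = i"; cases "k = j") (auto simp: f_def)
    then show ?thesis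
    proof cases
      case 1
      then show ?thesis using gaussian_moments(1)[OF S[of k], of a] by simp
    next
      case 2
      then show ?thesis using gaussian_moments(1)[OF S[of k], of b] by simp
    next
      case 3
      then show ?thesis
        using has_bochner_integral_prob_const[OF prob_space_gaussian[OF S[of k]], of 1] by simp
    qed
  qed
  have "has_bochner_integral (PiM I (\<lambda>i. gaussian (S i))) (\<lambda>w. \<Prod>k\<in>I. f k (w k)) 0"
    using m ij(1) unfolding has_bochner_integral_iff
    by (auto intro!: product_integrable_prod I bexI[of _ i] simp: product_integral_prod[OF I] prod_zero_iff[OF I])
  moreover have "(\<Prod>k\<in>I. f k (w k)) = (a \<bullet> w i) * (b \<bullet> w j)" for w
  proof -
    have "(\<Prod>k\<in>I. f k (w k)) = (\<Prod>k\<in>{i, j}. f k (w k))"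
      using ij I by (intro prod.mono_neutral_right) (auto simp: f_def)
    then show ?thesis using False by (simp add: f_def)
  qed
  ultimately show ?thesis using False by simp
qed

lemma gaussian_product_linear:
  "has_bochner_integral (PiM I (\<lambda>i. gaussian (S i))) (\<lambda>w. \<Sum>i\<in>I. \<alpha> i \<bullet> w i) 0"
proof -
  have "has_bochner_integral (PiM I (\<lambda>i. gaussian (S i))) (\<lambda>w. \<Sum>i\<in>I. \<alpha> i \<bullet> w i) (\<Sum>i\<in>I. 0)"
    by (intro has_bochner_integral_sum gaussian_product_component[where f = "\<lambda>x. \<alpha> _ \<bullet> x"] gaussian_moments S) auto
  then show ?thesis by simp
qed

lemma gaussian_product_bilinear:
  "has_bochner_integral (PiM I (\<lambda>i. gaussian (S i)))
     (\<lambda>w. (\<Sum>i\<in>I. \<alpha> i \<bullet> w i) * (\<Sum>i\<in>I. \<beta> i \<bullet> w i)) (\<Sum>i\<in>I. \<alpha> i \<bullet> (S i *v \<beta> i))"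
proof -
  have "has_bochner_integral (PiM I (\<lambda>i. gaussian (S i)))
     (\<lambda>w. \<Sum>i\<in>I. \<Sum>j\<in>I. (\<alpha> i \<bullet> w i) * (\<beta> j \<bullet> w j))
     (\<Sum>i\<in>I. \<Sum>j\<in>I. if i = j then \<alpha> i \<bullet> (S i *v \<beta> j) else 0)"
    by (intro has_bochner_integral_sum gaussian_product_cross)
  then show ?thesis
    using I by (simp add: sum_product)
qed

end

text \<open>
  The joint law in terms of covariances, with the initial state and the process noise in one family,
  so that all disturbances are treated alike.
\<close>

definition gaussian_law ::
  "nat \<Rightarrow> (nat \<Rightarrow> real^'n^'n) \<Rightarrow> (nat \<Rightarrow> real^'p^'p) \<Rightarrow> ('n, 'p) outcome measure" where
  "gaussian_law T S V = PiM {..T} (\<lambda>i. gaussian (S i)) \<Otimes>\<^sub>M PiM {..<T} (\<lambda>i. gaussian (V i))"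

definition affine_functional :: "nat \<Rightarrow> (('n::finite, 'p::finite) outcome \<Rightarrow> real) \<Rightarrow> bool" where
  "affine_functional T f \<longleftrightarrow> (\<exists>c \<alpha> \<beta>. \<forall>w v. f (w, v) =
     c + ((\<Sum>i\<le>T. \<alpha> i \<bullet> w i) + (\<Sum>i<T. \<beta> i \<bullet> v i)))"

text \<open>
  Integrability is part of the notion, because linearity of the expectation is what makes the class
  closed under sums.
\<close>

definition covariance_affine :: "nat \<Rightarrow> (('n::finite, 'p::finite) outcome \<Rightarrow> real) \<Rightarrow> bool" where
  "covariance_affine T h \<longleftrightarrow> (\<exists>c M N. \<forall>S V. (\<forall>i. pos_def (S i)) \<longrightarrow> (\<forall>i. pos_def (V i)) \<longrightarrow>
     has_bochner_integral (gaussian_law T S V) h (c + ((\<Sum>i\<le>T. M i \<bullet> S i) + (\<Sum>i<T. N i \<bullet> V i))))"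

lemma inner_mv_eq_outer: "a \<bullet> (S *v b) = (\<chi> i j. a $ i * b $ j) \<bullet> (S :: real^'n^'m)"
  by (simp add: inner_vec_def matrix_vector_mult_def sum_distrib_left mult_ac)

text \<open>
  Of the nine products of summands, only the constant one and the two that pair noise of the same kind
  have a nonzero expectation. The bilinear form in the covariance is the inner product with an
  outer product, by \<open>inner_mv_eq_outer\<close>.
\<close>

lemma covariance_affine_product:
  assumes "affine_functional T f" "affine_functional T g"
  shows "covariance_affine T (\<lambda>\<omega>. f \<omega> * g \<omega>)"
proof -
  obtain c \<alpha> \<beta> where f: "\<And>w v. f (w, v) = c + ((\<Sum>i\<le>T. \<alpha> i \<bullet> w i) + (\<Sum>i<T. \<beta> i \<bullet> v i))"
    using assms(1) by (auto simp: affine_functional_def)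
  obtain c' \<alpha>' \<beta>' where g: "\<And>w v. g (w, v) = c' + ((\<Sum>i\<le>T. \<alpha>' i \<bullet> w i) + (\<Sum>i<T. \<beta>' i \<bullet> v i))"
    using assms(2) by (auto simp: affine_functional_def)
  define l where "l = (\<lambda>w. \<Sum>i\<le>T. \<alpha> i \<bullet> w i)"
  define l' where "l' = (\<lambda>w. \<Sum>i\<le>T. \<alpha>' i \<bullet> w i)"
  define m where "m = (\<lambda>v. \<Sum>i<T. \<beta> i \<bullet> v i)"
  define m' where "m' = (\<lambda>v. \<Sum>i<T. \<beta>' i \<bullet> v i)"
  have fg: "f (w, v) = c + (l w + m v)" "g (w, v) = c' + (l' w + m' v)" for w v
    by (simp_all add: f g l_def l'_def m_def m'_def)
  have "has_bochner_integral (gaussian_law T S V) (\<lambda>\<omega>. f \<omega> * g \<omega>)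
      (c * c' + ((\<Sum>i\<le>T. \<alpha> i \<bullet> (S i *v \<alpha>' i)) + (\<Sum>i<T. \<beta> i \<bullet> (V i *v \<beta>' i))))"
    if S: "\<And>i. pos_def (S i)" and V: "\<And>i. pos_def (V i)" for S V
  proof -
    let ?P = "PiM {..T} (\<lambda>i. gaussian (S i))" and ?Q = "PiM {..<T} (\<lambda>i. gaussian (V i))"
    interpret P: prob_space ?P by (rule prob_space_gaussian_product) (use S in auto)
    interpret Q: prob_space ?Q by (rule prob_space_gaussian_product) (use V in auto)
    note P1 = has_bochner_integral_prob_const[OF P.prob_space_axioms]
      and Q1 = has_bochner_integral_prob_const[OF Q.prob_space_axioms]
    have P: "has_bochner_integral ?P l 0" "has_bochner_integral ?P l' 0"
      "has_bochner_integral ?P (\<lambda>w. l w * l' w) (\<Sum>i\<le>T. \<alpha> i \<bullet> (S i *v \<alpha>' i))"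
      unfolding l_def l'_def using S by (auto intro!: gaussian_product_linear gaussian_product_bilinear)
    have Q: "has_bochner_integral ?Q m 0" "has_bochner_integral ?Q m' 0"
      "has_bochner_integral ?Q (\<lambda>w. m w * m' w) (\<Sum>i<T. \<beta> i \<bullet> (V i *v \<beta>' i))"
      unfolding m_def m'_def using V by (auto intro!: gaussian_product_linear gaussian_product_bilinear)
    have R: "has_bochner_integral (?P \<Otimes>\<^sub>M ?Q) (\<lambda>(w, v). h w * k v) (x * y)"
      if "has_bochner_integral ?P h x" "has_bochner_integral ?Q k y"
      for h k :: "_ \<Rightarrow> real" and x y
      by (rule has_bochner_integral_pair_product[OF P.sigma_finite_measure_axioms Q.sigma_finite_measure_axioms that])
    have "has_bochner_integral (?P \<Otimes>\<^sub>M ?Q) (\<lambda>\<omega>.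
        (case \<omega> of (w, v) \<Rightarrow> c * c') + (case \<omega> of (w, v) \<Rightarrow> c * m' v) + (case \<omega> of (w, v) \<Rightarrow> l' w * c) +
        (case \<omega> of (w, v) \<Rightarrow> l w * c') + (case \<omega> of (w, v) \<Rightarrow> l w * m' v) + (case \<omega> of (w, v) \<Rightarrow> (l w * l' w) * 1) +
        (case \<omega> of (w, v) \<Rightarrow> c' * m v) + (case \<omega> of (w, v) \<Rightarrow> l' w * m v) + (case \<omega> of (w, v) \<Rightarrow> 1 * (m v * m' v)))
       (c * c' + c * 0 + 0 * c + 0 * c' + 0 * 0 + (\<Sum>i\<le>T. \<alpha> i \<bullet> (S i *v \<alpha>' i)) * 1 + c' * 0 + 0 * 0 +
        1 * (\<Sum>i<T. \<beta> i \<bullet> (V i *v \<beta>' i)))"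
      by (intro has_bochner_integral_add R P Q P1 Q1)
    moreover have "(\<lambda>\<omega>.
        (case \<omega> of (w, v) \<Rightarrow> c * c') + (case \<omega> of (w, v) \<Rightarrow> c * m' v) + (case \<omega> of (w, v) \<Rightarrow> l' w * c) +
        (case \<omega> of (w, v) \<Rightarrow> l w * c') + (case \<omega> of (w, v) \<Rightarrow> l w * m' v) + (case \<omega> of (w, v) \<Rightarrow> (l w * l' w) * 1) +
        (case \<omega> of (w, v) \<Rightarrow> c' * m v) + (case \<omega> of (w, v) \<Rightarrow> l' w * m v) + (case \<omega> of (w, v) \<Rightarrow> 1 * (m v * m' v)))
      = (\<lambda>\<omega>. f \<omega> * g \<omega>)"
      by (auto simp: fun_eq_iff fg algebra_simps)
    ultimately have "has_bochner_integral (?P \<Otimes>\<^sub>M ?Q) (\<lambda>\<omega>. f \<omega> * g \<omega>)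
       (c * c' + c * 0 + 0 * c + 0 * c' + 0 * 0 + (\<Sum>i\<le>T. \<alpha> i \<bullet> (S i *v \<alpha>' i)) * 1 + c' * 0 + 0 * 0 +
        1 * (\<Sum>i<T. \<beta> i \<bullet> (V i *v \<beta>' i)))"
      by (simp only:)
    then show ?thesis
      by (simp add: gaussian_law_def add.assoc)
  qed
  then show ?thesis
    unfolding covariance_affine_def inner_mv_eq_outer
    by (intro exI[of _ "c * c'"] exI[of _ "\<lambda>i. \<chi> j k. \<alpha> i $ j * \<alpha>' i $ k"]
        exI[of _ "\<lambda>i. \<chi> j k. \<beta> i $ j * \<beta>' i $ k"]) blast
qed

lemma covariance_affine_0: "covariance_affine T (\<lambda>_. 0)"
  unfolding covariance_affine_def
  by (intro exI[of _ 0] exI[of _ "\<lambda>_. 0"]) (simp add: has_bochner_integral_zero)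

lemma covariance_affine_add:
  assumes "covariance_affine T f" "covariance_affine T g"
  shows "covariance_affine T (\<lambda>\<omega>. f \<omega> + g \<omega>)"
proof -
  obtain c M N where f: "\<And>S V. (\<forall>i. pos_def (S i)) \<Longrightarrow> (\<forall>i. pos_def (V i)) \<Longrightarrow>
     has_bochner_integral (gaussian_law T S V) f (c + ((\<Sum>i\<le>T. M i \<bullet> S i) + (\<Sum>i<T. N i \<bullet> V i)))"
    using assms(1) unfolding covariance_affine_def by blast
  obtain c' M' N' where g: "\<And>S V. (\<forall>i. pos_def (S i)) \<Longrightarrow> (\<forall>i. pos_def (V i)) \<Longrightarrow>
     has_bochner_integral (gaussian_law T S V) g (c' + ((\<Sum>i\<le>T. M' i \<bullet> S i) + (\<Sum>i<T. N' i \<bullet> V i)))"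
    using assms(2) unfolding covariance_affine_def by blast
  have "has_bochner_integral (gaussian_law T S V) (\<lambda>\<omega>. f \<omega> + g \<omega>)
     (c + c' + ((\<Sum>i\<le>T. (M i + M' i) \<bullet> S i) + (\<Sum>i<T. (N i + N' i) \<bullet> V i)))"
    if "\<forall>i. pos_def (S i)" "\<forall>i. pos_def (V i)" for S V
    using has_bochner_integral_add[OF f[OF that] g[OF that]]
    by (simp add: inner_add_left sum.distrib algebra_simps)
  then show ?thesis
    unfolding covariance_affine_def
    by (intro exI[of _ "c + c'"] exI[of _ "\<lambda>i. M i + M' i"] exI[of _ "\<lambda>i. N i + N' i"]) blast
qed

lemma covariance_affine_sum:
  "finite A \<Longrightarrow> (\<And>a. a \<in> A \<Longrightarrow> covariance_affine T (f a)) \<Longrightarrow> covariance_affine T (\<lambda>\<omega>. \<Sum>a\<in>A. f a \<omega>)"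
  by (induction A rule: finite_induct) (auto intro: covariance_affine_0 covariance_affine_add)

lemma affine_functional_const: "affine_functional T (\<lambda>_. c)"
  unfolding affine_functional_def by (intro exI[of _ c] exI[of _ "\<lambda>_. 0"]) simp

lemma affine_functional_add:
  assumes "affine_functional T f" "affine_functional T g"
  shows "affine_functional T (\<lambda>\<omega>. f \<omega> + g \<omega>)"
proof -
  obtain c \<alpha> \<beta> where f: "\<And>w v. f (w, v) = c + ((\<Sum>i\<le>T. \<alpha> i \<bullet> w i) + (\<Sum>i<T. \<beta> i \<bullet> v i))"
    using assms(1) by (auto simp: affine_functional_def)
  obtain c' \<alpha>' \<beta>' where g: "\<And>w v. g (w, v) = c' + ((\<Sum>i\<le>T. \<alpha>' i \<bullet> w i) + (\<Sum>i<T. \<beta>' i \<bullet> v i))"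
    using assms(2) by (auto simp: affine_functional_def)
  show ?thesis
    unfolding affine_functional_def
    by (intro exI[of _ "c + c'"] exI[of _ "\<lambda>i. \<alpha> i + \<alpha>' i"] exI[of _ "\<lambda>i. \<beta> i + \<beta>' i"])
       (simp add: f g inner_add_left sum.distrib)
qed

lemma affine_functional_scale:
  assumes "affine_functional T f"
  shows "affine_functional T (\<lambda>\<omega>. k * f \<omega>)"
proof -
  obtain c \<alpha> \<beta> where f: "\<And>w v. f (w, v) = c + ((\<Sum>i\<le>T. \<alpha> i \<bullet> w i) + (\<Sum>i<T. \<beta> i \<bullet> v i))"
    using assms(1) by (auto simp: affine_functional_def)
  show ?thesis
    unfolding affine_functional_def
    by (intro exI[of _ "k * c"] exI[of _ "\<lambda>i. k *\<^sub>R \<alpha> i"] exI[of _ "\<lambda>i. k *\<^sub>R \<beta> i"])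
       (simp add: f distrib_left sum_distrib_left)
qed

lemma affine_functional_sum:
  "finite A \<Longrightarrow> (\<And>a. a \<in> A \<Longrightarrow> affine_functional T (f a)) \<Longrightarrow> affine_functional T (\<lambda>\<omega>. \<Sum>a\<in>A. f a \<omega>)"
  by (induction A rule: finite_induct) (auto intro: affine_functional_const affine_functional_add)

lemma affine_functional_coordinate:
  shows "t \<le> T \<Longrightarrow> affine_functional T (\<lambda>\<omega>. fst \<omega> t $ i)"
    and "t < T \<Longrightarrow> affine_functional T (\<lambda>\<omega>. snd \<omega> t $ i)"
proof -
  have delta: "(if k = t then axis i 1 else 0) \<bullet> x = (if k = t then x $ i else 0)" for k and x :: "real^'z" and i
    by (simp add: inner_axis')
  show "affine_functional T (\<lambda>\<omega>. fst \<omega> t $ i)" if "t \<le> T"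
    unfolding affine_functional_def
    by (intro exI[of _ 0] exI[of _ "\<lambda>k. if k = t then axis i 1 else 0"] exI[of _ "\<lambda>_. 0"])
       (use that in \<open>simp add: delta\<close>)
  show "affine_functional T (\<lambda>\<omega>. snd \<omega> t $ i)" if "t < T"
    unfolding affine_functional_def
    by (intro exI[of _ 0] exI[of _ "\<lambda>k. if k = t then axis i 1 else 0"] exI[of _ "\<lambda>_. 0"])
       (use that in \<open>simp add: delta\<close>)
qed

lemma affine_functional_blk_mv:
  assumes "\<And>s j. s < N \<Longrightarrow> affine_functional T (\<lambda>\<omega>. X \<omega> s $ j)"
  shows "affine_functional T (\<lambda>\<omega>. blk_mv N M (X \<omega>) t $ i)"
  unfolding blk_mv_def matrix_vector_mult_def sum_component vec_lambda_beta
  by (intro affine_functional_sum affine_functional_scale assms) auto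

lemma covariance_affine_blk_quad:
  assumes "\<And>s j. s < N \<Longrightarrow> affine_functional T (\<lambda>\<omega>. X \<omega> s $ j)"
  shows "covariance_affine T (\<lambda>\<omega>. blk_quad N M (X \<omega>))"
  unfolding blk_quad_def inner_vec_def inner_real_def
  by (intro covariance_affine_sum covariance_affine_product affine_functional_blk_mv assms) auto

section \<open>The control problem\<close>

text \<open>
  Tychonoff's theorem for the product topology on functions.
\<close>

lemma compact_Pi_UNIV:
  fixes K :: "'i \<Rightarrow> 'a::topological_space set"
  assumes "\<And>i. compact (K i)"
  shows "compact (Pi UNIV K)"
proof -
  have "compactin (product_topology (\<lambda>i::'i. euclidean :: 'a topology) UNIV) (PiE UNIV K)"
    using assms by (simp add: compactin_PiE)
  then show ?thesis
    by (simp add: euclidean_product_topology PiE_UNIV_domain)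
qed

lemma blk_mv_combination_matrix:
  "blk_mv N (\<lambda>t s. a *\<^sub>R M t s + b *\<^sub>R L t s) x t = a *\<^sub>R blk_mv N M x t + b *\<^sub>R blk_mv N L x t"
  by (simp add: blk_mv_def mv_scaleR_add sum.distrib scaleR_sum_right)

lemma blk_mv_combination_vector:
  "blk_mv N M (\<lambda>s. a *\<^sub>R x s + b *\<^sub>R y s) t = a *\<^sub>R blk_mv N M x t + b *\<^sub>R blk_mv N M y t"
  by (simp add: blk_mv_def matrix_vector_right_distrib matrix_vector_mult_scaleR sum.distrib scaleR_sum_right)

text \<open>
  The gap is \<open>a (1 - a)\<close> times the value of the form at \<open>x - y\<close>.
\<close>

lemma quadratic_form_convex:
  fixes M :: "real^'n^'n"
  assumes "psd M" "0 \<le> a" "a \<le> 1"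
  shows "(a *\<^sub>R x + (1 - a) *\<^sub>R y) \<bullet> (M *v (a *\<^sub>R x + (1 - a) *\<^sub>R y)) \<le>
    a * (x \<bullet> (M *v x)) + (1 - a) * (y \<bullet> (M *v y))"
proof -
  have "0 \<le> a * (1 - a) * ((x - y) \<bullet> (M *v (x - y)))"
    using assms by (simp add: psd_def)
  also have "\<dots> = a * (x \<bullet> (M *v x)) + (1 - a) * (y \<bullet> (M *v y)) -
      (a *\<^sub>R x + (1 - a) *\<^sub>R y) \<bullet> (M *v (a *\<^sub>R x + (1 - a) *\<^sub>R y))"
    by (simp add: matrix_vector_right_distrib matrix_vector_mult_diff_distrib matrix_vector_mult_scaleR
        inner_add_left inner_add_right inner_diff_left inner_diff_right algebra_simps)
  finally show ?thesis by simp
qed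

lemma blk_quad_diagonal:
  "blk_quad N (\<lambda>t s. if t = s then M t else 0) x = (\<Sum>t<N. x t \<bullet> (M t *v x t))"
proof -
  have "blk_mv N (\<lambda>t s. if t = s then M t else 0) x t = M t *v x t" if "t < N" for t
  proof -
    have "blk_mv N (\<lambda>t s. if t = s then M t else 0) x t = (\<Sum>s<N. if s = t then M t *v x t else 0)"
      unfolding blk_mv_def by (intro sum.cong) auto
    then show ?thesis using that by simp
  qed
  then show ?thesis by (simp add: blk_quad_def)
qed

lemma blk_quad_diagonal_convex:
  assumes "\<And>t. psd (M t)" "0 \<le> a" "a \<le> 1"
  shows "blk_quad N (\<lambda>t s. if t = s then M t else 0) (\<lambda>t. a *\<^sub>R x t + (1 - a) *\<^sub>R y t) \<le>
    a * blk_quad N (\<lambda>t s. if t = s then M t else 0) x + (1 - a) * blk_quad N (\<lambda>t s. if t = s then M t else 0) y"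
  unfolding blk_quad_diagonal sum_distrib_left sum.distrib[symmetric]
  by (intro sum_mono quadratic_form_convex assms)

lemma psd_if_pos_def: "pos_def M \<Longrightarrow> psd M"
  unfolding psd_def pos_def_def by (metis inner_zero_left less_eq_real_def)

definition quadratic_cost ::
  "nat \<Rightarrow> real^'n^'n \<Rightarrow> real^'n^'n \<Rightarrow> real^'m^'m \<Rightarrow> (nat \<Rightarrow> real^'n) \<Rightarrow> (nat \<Rightarrow> real^'m) \<Rightarrow> real" where
  "quadratic_cost T Q QT R x u = blk_quad T (bold_R R) u + blk_quad (T + 1) (bold_Q T Q QT) x"

text \<open>
  Applied outcome by outcome, this makes the expected cost convex in the policy under every law.
\<close>

lemma quadratic_cost_convex:
  assumes "psd Q" "psd QT" "psd R" and a: "0 \<le> a" "a \<le> 1"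
  shows "quadratic_cost T Q QT R (\<lambda>t. a *\<^sub>R x t + (1 - a) *\<^sub>R x' t) (\<lambda>t. a *\<^sub>R u t + (1 - a) *\<^sub>R u' t) \<le>
    a * quadratic_cost T Q QT R x u + (1 - a) * quadratic_cost T Q QT R x' u'"
proof -
  have u: "blk_quad T (bold_R R) (\<lambda>t. a *\<^sub>R u t + (1 - a) *\<^sub>R u' t) \<le>
      a * blk_quad T (bold_R R) u + (1 - a) * blk_quad T (bold_R R) u'"
    unfolding bold_R_def by (rule blk_quad_diagonal_convex) fact+
  have "blk_quad (T + 1) (bold_Q T Q QT) (\<lambda>t. a *\<^sub>R x t + (1 - a) *\<^sub>R x' t) \<le>
      a * blk_quad (T + 1) (bold_Q T Q QT) x + (1 - a) * blk_quad (T + 1) (bold_Q T Q QT) x'"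
    unfolding bold_Q_def by (rule blk_quad_diagonal_convex) (use assms in auto)
  with u show ?thesis
    unfolding quadratic_cost_def distrib_left by linarith
qed

text \<open>
  Mixing the outputs of two policies, outcome by outcome, is the policy with mixed gains and offsets;
  the state equation is linear, and the weights of the disturbance term add up to one.
\<close>

lemma feasible_combination:
  assumes f1: "(x1, u1) \<in> feasible T A B C" and f2: "(x2, u2) \<in> feasible T A B C"
  shows "(\<lambda>\<omega> t. a *\<^sub>R x1 \<omega> t + (1 - a) *\<^sub>R x2 \<omega> t, \<lambda>\<omega> t. a *\<^sub>R u1 \<omega> t + (1 - a) *\<^sub>R u2 \<omega> t) \<in> feasible T A B C"
proof -
  obtain U1 q1 where 1: "block_lower_triangular T U1"
    "\<And>\<omega> t. t < T \<Longrightarrow> u1 \<omega> t = blk_mv T U1 (purified_obs T A C \<omega>) t + q1 t"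
    using f1 by (auto simp: feasible_def affine_policies_def)
  obtain U2 q2 where 2: "block_lower_triangular T U2"
    "\<And>\<omega> t. t < T \<Longrightarrow> u2 \<omega> t = blk_mv T U2 (purified_obs T A C \<omega>) t + q2 t"
    using f2 by (auto simp: feasible_def affine_policies_def)
  have "(\<lambda>\<omega> t. a *\<^sub>R u1 \<omega> t + (1 - a) *\<^sub>R u2 \<omega> t) \<in> affine_policies T A C"
    unfolding affine_policies_def mem_Collect_eq
    by (rule exI[of _ "\<lambda>t s. a *\<^sub>R U1 t s + (1 - a) *\<^sub>R U2 t s"], rule exI[of _ "\<lambda>t. a *\<^sub>R q1 t + (1 - a) *\<^sub>R q2 t"])
       (use 1 2 in \<open>simp add: block_lower_triangular_def blk_mv_combination_matrix scaleR_add_right\<close>)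
  moreover have "a *\<^sub>R x1 (w, v) t + (1 - a) *\<^sub>R x2 (w, v) t =
      blk_mv T (bold_H A B) (\<lambda>t. a *\<^sub>R u1 (w, v) t + (1 - a) *\<^sub>R u2 (w, v) t) t + blk_mv (T + 1) (bold_G A) w t"
    if "t \<le> T" for w v t
  proof -
    have x1: "x1 (w, v) t = blk_mv T (bold_H A B) (u1 (w, v)) t + blk_mv (T + 1) (bold_G A) w t"
      and x2: "x2 (w, v) t = blk_mv T (bold_H A B) (u2 (w, v)) t + blk_mv (T + 1) (bold_G A) w t"
      using f1 f2 that by (auto simp: feasible_def)
    show ?thesis
      unfolding x1 x2 blk_mv_combination_vector by (simp add: algebra_simps)
  qed
  ultimately show ?thesis
    by (simp add: feasible_def)
qed

lemma affine_functional_blk_mv_disturbance: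
  "affine_functional T (\<lambda>\<omega>. blk_mv (T + 1) M (fst \<omega>) t $ j)"
  by (intro affine_functional_blk_mv affine_functional_coordinate) simp

text \<open>
  Purified observations, inputs and states are, component by component, affine in the disturbances.
\<close>

lemma covariance_affine_quadratic_cost:
  assumes "(x, u) \<in> feasible T A B C"
  shows "covariance_affine T (\<lambda>\<omega>. quadratic_cost T Q QT R (x \<omega>) (u \<omega>))"
proof -
  obtain U q where u: "\<And>\<omega> t. t < T \<Longrightarrow> u \<omega> t = blk_mv T U (purified_obs T A C \<omega>) t + q t"
    using assms by (auto simp: feasible_def affine_policies_def)
  have x: "x \<omega> t = blk_mv T (bold_H A B) (u \<omega>) t + blk_mv (T + 1) (bold_G A) (fst \<omega>) t" if "t \<le> T" for \<omega> t
    using assms that by (cases \<omega>) (auto simp: feasible_def)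
  have "affine_functional T (\<lambda>\<omega>. purified_obs T A C \<omega> s $ j)" if "s < T" for s j
    unfolding purified_obs_def case_prod_unfold vector_add_component
    using that by (intro affine_functional_add affine_functional_blk_mv_disturbance affine_functional_coordinate)
  then have ua: "affine_functional T (\<lambda>\<omega>. u \<omega> s $ j)" if "s < T" for s j
    using that unfolding u[OF that] vector_add_component
    by (intro affine_functional_add affine_functional_blk_mv affine_functional_const) auto
  have xa: "affine_functional T (\<lambda>\<omega>. x \<omega> s $ j)" if "s < T + 1" for s j
  proof -
    have "s \<le> T" using that by simp
    then show ?thesis
      unfolding x[OF \<open>s \<le> T\<close>] vector_add_component
      by (intro affine_functional_add affine_functional_blk_mv affine_functional_blk_mv_disturbance ua)
  qed
  show ?thesis
    unfolding quadratic_cost_def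
    by (intro covariance_affine_add covariance_affine_blk_quad ua xa)
qed

lemma has_bochner_integral_le:
  fixes f g :: "'a \<Rightarrow> real"
  assumes "has_bochner_integral M f x" "has_bochner_integral M g y" "\<And>\<omega>. f \<omega> \<le> g \<omega>"
  shows "x \<le> y"
  using assms integral_mono[of M f g] by (auto simp: has_bochner_integral_iff)

lemma expected_cost_eq: "expected_cost T Q QT R x u P = (\<integral>\<omega>. quadratic_cost T Q QT R (x \<omega>) (u \<omega>) \<partial>P)"
  by (simp add: expected_cost_def quadratic_cost_def)

lemma feasible_nonempty: "feasible T A B C \<noteq> {}"
proof -
  have "(\<lambda>\<omega> t. blk_mv (T + 1) (bold_G A) (fst \<omega>) t, \<lambda>\<omega> t. 0) \<in> feasible T A B C"
    unfolding feasible_def affine_policies_def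
    by (auto simp: blk_mv_def block_lower_triangular_def intro!: exI[of _ "\<lambda>_ _. 0"] exI[of _ "\<lambda>_. 0"])
  then show ?thesis by blast
qed

text \<open>
  Indices without a disturbance get the constant value \<open>mat 1\<close>: a singleton keeps the product compact
  and convex, and its member is positive definite.
\<close>

definition admissible_covariances ::
  "nat \<Rightarrow> (nat \<Rightarrow> real) \<Rightarrow> (nat \<Rightarrow> real^'n^'n) \<Rightarrow> nat \<Rightarrow> (real^'n^'n) set" where
  "admissible_covariances N \<rho> S0 i = (if i < N then covariance_ball (\<rho> i) (S0 i) else {mat 1})"

lemma pos_def_mat_1: "pos_def (mat 1 :: real^'n^'n)"
  by (simp add: pos_def_def transpose_mat)

lemma pos_def_if_admissible: "S \<in> Pi UNIV (admissible_covariances N \<rho> S0) \<Longrightarrow> pos_def (S i)"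
proof -
  assume "S \<in> Pi UNIV (admissible_covariances N \<rho> S0)"
  then have "S i \<in> admissible_covariances N \<rho> S0 i" by auto
  then show "pos_def (S i)"
    by (auto simp: admissible_covariances_def covariance_ball_def pos_def_mat_1 split: if_splits)
qed

lemma compact_admissible_covariances:
  assumes "\<And>i. i < N \<Longrightarrow> pos_def (S0 i)"
  shows "compact (Pi UNIV (admissible_covariances N \<rho> S0))"
  using assms by (intro compact_Pi_UNIV) (simp add: admissible_covariances_def compact_covariance_ball)

lemma admissible_covariances_combination:
  assumes "S \<in> Pi UNIV (admissible_covariances N \<rho> S0)" "S' \<in> Pi UNIV (admissible_covariances N \<rho> S0)" "0 \<le> a" "a \<le> 1"
  shows "(\<lambda>i. a *\<^sub>R S i + (1 - a) *\<^sub>R S' i) \<in> Pi UNIV (admissible_covariances N \<rho> S0)"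
proof
  fix i
  have "convex (admissible_covariances N \<rho> S0 i)"
    by (simp add: admissible_covariances_def convex_covariance_ball)
  moreover have "S i \<in> admissible_covariances N \<rho> S0 i" "S' i \<in> admissible_covariances N \<rho> S0 i"
    using assms by auto
  ultimately show "a *\<^sub>R S i + (1 - a) *\<^sub>R S' i \<in> admissible_covariances N \<rho> S0 i"
    using assms(3,4) by (intro convexD) auto
qed

text \<open>
  The initial state becomes index \<open>0\<close> of the process noise, hence the shift by one in the families of
  radii and nominal covariances.
\<close>

lemma ambiguity_set_eq:
  fixes X0 :: "real^'n^'n" and W :: "nat \<Rightarrow> real^'n^'n" and V :: "nat \<Rightarrow> real^'p^'p"
  assumes X0: "pos_def X0" and W: "\<And>t. t < T \<Longrightarrow> pos_def (W t)" and V: "\<And>t. t < T \<Longrightarrow> pos_def (V t)"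
  shows "ambiguity_set T \<rho>x \<rho>w \<rho>v X0 W V = (\<lambda>y. gaussian_law T (fst y) (snd y)) `
    (Pi UNIV (admissible_covariances (Suc T) (case_nat \<rho>x \<rho>w) (case_nat X0 W)) \<times>
     Pi UNIV (admissible_covariances T \<rho>v V))" (is "_ = ?g ` (?S \<times> ?V)")
proof (intro equalityI subsetI)
  fix P assume "P \<in> ambiguity_set T \<rho>x \<rho>w \<rho>v X0 W V"
  then obtain Px Pw Pv where P: "P = joint_law T Px Pw Pv" and Px: "Px \<in> gaussian_ball \<rho>x X0"
    and Pw: "\<And>t. t < T \<Longrightarrow> Pw t \<in> gaussian_ball (\<rho>w t) (W t)"
    and Pv: "\<And>t. t < T \<Longrightarrow> Pv t \<in> gaussian_ball (\<rho>v t) (V t)"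
    unfolding ambiguity_set_def by blast
  obtain s0 where s0: "Px = gaussian s0" "s0 \<in> covariance_ball \<rho>x X0"
    using Px unfolding gaussian_ball_eq[OF X0] by blast
  have "\<forall>t. \<exists>s. t < T \<longrightarrow> Pw t = gaussian s \<and> s \<in> covariance_ball (\<rho>w t) (W t)"
    using Pw gaussian_ball_eq[OF W] by blast
  then obtain s where s: "\<And>t. t < T \<Longrightarrow> Pw t = gaussian (s t) \<and> s t \<in> covariance_ball (\<rho>w t) (W t)"
    by metis
  have "\<forall>t. \<exists>r. t < T \<longrightarrow> Pv t = gaussian r \<and> r \<in> covariance_ball (\<rho>v t) (V t)"
    using Pv gaussian_ball_eq[OF V] by blast
  then obtain r where r: "\<And>t. t < T \<Longrightarrow> Pv t = gaussian (r t) \<and> r t \<in> covariance_ball (\<rho>v t) (V t)"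
    by metis
  define S' where "S' = (\<lambda>i. if i \<le> T then case_nat s0 s i else mat 1)"
  define V' where "V' = (\<lambda>i. if i < T then r i else mat 1)"
  have "S' \<in> ?S"
    using s0 s by (auto simp: S'_def admissible_covariances_def split: nat.splits)
  moreover have "V' \<in> ?V"
    using r by (auto simp: V'_def admissible_covariances_def)
  moreover have "P = gaussian_law T S' V'"
    unfolding P joint_law_def gaussian_law_def
    by (intro arg_cong2[where f = pair_measure] PiM_cong)
       (use s0 s r in \<open>auto simp: S'_def V'_def split: nat.splits\<close>)
  ultimately show "P \<in> ?g ` (?S \<times> ?V)"
    by (intro image_eqI[of _ _ "(S', V')"]) auto
next
  fix P assume "P \<in> ?g ` (?S \<times> ?V)"
  then obtain S' V' where P: "P = gaussian_law T S' V'" and S': "S' \<in> ?S" and V': "V' \<in> ?V"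
    by auto
  have s: "S' i \<in> admissible_covariances (Suc T) (case_nat \<rho>x \<rho>w) (case_nat X0 W) i" for i
    using S' by auto
  have v: "V' i \<in> admissible_covariances T \<rho>v V i" for i
    using V' by auto
  have "gaussian (S' 0) \<in> gaussian_ball \<rho>x X0"
    using s[of 0] by (simp add: admissible_covariances_def gaussian_ball_eq[OF X0])
  moreover have "gaussian (S' (Suc t)) \<in> gaussian_ball (\<rho>w t) (W t)" if "t < T" for t
    using s[of "Suc t"] that by (simp add: admissible_covariances_def gaussian_ball_eq[OF W])
  moreover have "gaussian (V' t) \<in> gaussian_ball (\<rho>v t) (V t)" if "t < T" for t
    using v[of t] that by (simp add: admissible_covariances_def gaussian_ball_eq[OF V])
  moreover have "P = joint_law T (gaussian (S' 0)) (\<lambda>t. gaussian (S' (Suc t))) (\<lambda>t. gaussian (V' t))"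
  proof -
    have "(\<lambda>i. gaussian (S' i)) = case_nat (gaussian (S' 0)) (\<lambda>t. gaussian (S' (Suc t)))"
      by (auto split: nat.splits)
    then show ?thesis
      by (simp add: P joint_law_def gaussian_law_def)
  qed
  ultimately show "P \<in> ambiguity_set T \<rho>x \<rho>w \<rho>v X0 W V"
    unfolding ambiguity_set_def by blast
qed

theorem proposition5:
  fixes A :: "real^'n^'n" and B :: "real^'m^'n" and C :: "real^'n^'p"
    and Q QT :: "real^'n^'n" and R :: "real^'m^'m" and T :: nat
    and X0 :: "real^'n^'n" and W :: "nat \<Rightarrow> real^'n^'n" and V :: "nat \<Rightarrow> real^'p^'p"
    and \<rho>x :: real and \<rho>w \<rho>v :: "nat \<Rightarrow> real"
  assumes "psd Q" and "psd QT" and "pos_def R"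
    and "pos_def X0" and "\<And>t. t < T \<Longrightarrow> pos_def (W t)" and "\<And>t. t < T \<Longrightarrow> pos_def (V t)"
    and "0 \<le> \<rho>x" and "\<And>t. t < T \<Longrightarrow> 0 \<le> \<rho>w t" and "\<And>t. t < T \<Longrightarrow> 0 \<le> \<rho>v t"
  shows "(INF (x, u) \<in> feasible T A B C. SUP P \<in> ambiguity_set T \<rho>x \<rho>w \<rho>v X0 W V.
            ereal (expected_cost T Q QT R x u P)) =
         (SUP P \<in> ambiguity_set T \<rho>x \<rho>w \<rho>v X0 W V. INF (x, u) \<in> feasible T A B C.
            ereal (expected_cost T Q QT R x u P))"
proof -
  let ?S = "Pi UNIV (admissible_covariances (Suc T) (case_nat \<rho>x \<rho>w) (case_nat X0 W))"
  let ?V = "Pi UNIV (admissible_covariances T \<rho>v V)"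
  define Y where "Y = ?S \<times> ?V"
  define law where "law = (\<lambda>y :: (nat \<Rightarrow> real^'n^'n) \<times> (nat \<Rightarrow> real^'p^'p). gaussian_law T (fst y) (snd y))"
  define cost where "cost = (\<lambda>p y. expected_cost T Q QT R (fst p) (snd p) (law y))"
  have amb: "ambiguity_set T \<rho>x \<rho>w \<rho>v X0 W V = law ` Y"
    unfolding law_def Y_def by (rule ambiguity_set_eq) (use assms in auto)
  have Y: "compact Y"
    unfolding Y_def using assms(4-6)
    by (intro compact_Times compact_admissible_covariances) (auto split: nat.splits)
  have pd: "\<forall>i. pos_def (fst y i)" "\<forall>i. pos_def (snd y i)" if "y \<in> Y" for y
    using that pos_def_if_admissible by (auto simp: Y_def)
  have formula: "\<exists>c M N. \<forall>y\<in>Y.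
      has_bochner_integral (law y) (\<lambda>\<omega>. quadratic_cost T Q QT R (fst p \<omega>) (snd p \<omega>)) (cost p y) \<and>
      cost p y = c + ((\<Sum>i\<le>T. M i \<bullet> fst y i) + (\<Sum>i<T. N i \<bullet> snd y i))"
    if "p \<in> feasible T A B C" for p
  proof -
    have "(fst p, snd p) \<in> feasible T A B C" using that by simp
    from covariance_affine_quadratic_cost[OF this] obtain c M N where
      *: "\<And>S V. \<forall>i. pos_def (S i) \<Longrightarrow> \<forall>i. pos_def (V i) \<Longrightarrow>
        has_bochner_integral (gaussian_law T S V) (\<lambda>\<omega>. quadratic_cost T Q QT R (fst p \<omega>) (snd p \<omega>))
          (c + ((\<Sum>i\<le>T. M i \<bullet> S i) + (\<Sum>i<T. N i \<bullet> V i)))"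
      unfolding covariance_affine_def by blast
    have "has_bochner_integral (law y) (\<lambda>\<omega>. quadratic_cost T Q QT R (fst p \<omega>) (snd p \<omega>)) (cost p y) \<and>
      cost p y = c + ((\<Sum>i\<le>T. M i \<bullet> fst y i) + (\<Sum>i<T. N i \<bullet> snd y i))" if "y \<in> Y" for y
      using *[OF pd[OF that]] by (simp add: law_def cost_def expected_cost_eq has_bochner_integral_iff)
    then show ?thesis by blast
  qed
  have "(INF p\<in>feasible T A B C. SUP y\<in>Y. ereal (cost p y)) = (SUP y\<in>Y. INF p\<in>feasible T A B C. ereal (cost p y))"
  proof (rule convexlike_concavelike_minimax[OF feasible_nonempty Y])
    fix p assume "p \<in> feasible T A B C"
    from formula[OF this] obtain c M N where
      *: "\<And>y. y \<in> Y \<Longrightarrow> cost p y = c + ((\<Sum>i\<le>T. M i \<bullet> fst y i) + (\<Sum>i<T. N i \<bullet> snd y i))"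
      by blast
    have coord: "continuous_on Y (\<lambda>y. fst y i)" "continuous_on Y (\<lambda>y. snd y i)" for i
      by (rule continuous_on_compose2[OF continuous_on_product_coordinates continuous_on_fst[OF continuous_on_id]], simp)
         (rule continuous_on_compose2[OF continuous_on_product_coordinates continuous_on_snd[OF continuous_on_id]], simp)
    have "continuous_on Y (\<lambda>y. c + ((\<Sum>i\<le>T. M i \<bullet> fst y i) + (\<Sum>i<T. N i \<bullet> snd y i)))"
      by (intro continuous_intros coord)
    then show "continuous_on Y (cost p)"
      by (rule continuous_on_eq) (simp add: *)
  next
    fix p p' and a :: real
    assume p: "p \<in> feasible T A B C" and p': "p' \<in> feasible T A B C" and a: "0 \<le> a" "a \<le> 1"
    define z where "z = (\<lambda>\<omega> t. a *\<^sub>R fst p \<omega> t + (1 - a) *\<^sub>R fst p' \<omega> t, \<lambda>\<omega> t. a *\<^sub>R snd p \<omega> t + (1 - a) *\<^sub>R snd p' \<omega> t)"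
    have z: "z \<in> feasible T A B C"
      unfolding z_def by (rule feasible_combination) (use p p' in auto)
    have "cost z y \<le> a * cost p y + (1 - a) * cost p' y" if y: "y \<in> Y" for y
    proof (rule has_bochner_integral_le)
      show "has_bochner_integral (law y) (\<lambda>\<omega>. quadratic_cost T Q QT R (fst z \<omega>) (snd z \<omega>)) (cost z y)"
        using formula[OF z] y by blast
      show "has_bochner_integral (law y) (\<lambda>\<omega>. a * quadratic_cost T Q QT R (fst p \<omega>) (snd p \<omega>) +
          (1 - a) * quadratic_cost T Q QT R (fst p' \<omega>) (snd p' \<omega>)) (a * cost p y + (1 - a) * cost p' y)"
        using formula[OF p] formula[OF p'] y
        by (intro has_bochner_integral_add has_bochner_integral_mult_right) blast+
      show "quadratic_cost T Q QT R (fst z \<omega>) (snd z \<omega>) \<le> a * quadratic_cost T Q QT R (fst p \<omega>) (snd p \<omega>) +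
          (1 - a) * quadratic_cost T Q QT R (fst p' \<omega>) (snd p' \<omega>)" for \<omega>
        unfolding z_def fst_conv snd_conv by (intro quadratic_cost_convex assms psd_if_pos_def a)
    qed
    then show "\<exists>z\<in>feasible T A B C. \<forall>y\<in>Y. cost z y \<le> a * cost p y + (1 - a) * cost p' y"
      using z by blast
  next
    fix y y' and a :: real
    assume y: "y \<in> Y" and y': "y' \<in> Y" and a: "0 \<le> a" "a \<le> 1"
    define z where "z = (\<lambda>i. a *\<^sub>R fst y i + (1 - a) *\<^sub>R fst y' i, \<lambda>i. a *\<^sub>R snd y i + (1 - a) *\<^sub>R snd y' i)"
    have z: "z \<in> Y"
      unfolding z_def Y_def
      by (intro SigmaI admissible_covariances_combination a; use y y' in \<open>simp add: Y_def mem_Times_iff\<close>)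
    have "a * cost p y + (1 - a) * cost p y' \<le> cost p z" if p: "p \<in> feasible T A B C" for p
    proof -
      obtain c M N where
        *: "\<And>y. y \<in> Y \<Longrightarrow> cost p y = c + ((\<Sum>i\<le>T. M i \<bullet> fst y i) + (\<Sum>i<T. N i \<bullet> snd y i))"
        using formula[OF p] by blast
      have sums: "(\<Sum>i\<le>T. M i \<bullet> fst z i) = a * (\<Sum>i\<le>T. M i \<bullet> fst y i) + (1 - a) * (\<Sum>i\<le>T. M i \<bullet> fst y' i)"
        "(\<Sum>i<T. N i \<bullet> snd z i) = a * (\<Sum>i<T. N i \<bullet> snd y i) + (1 - a) * (\<Sum>i<T. N i \<bullet> snd y' i)"
        by (simp_all add: z_def inner_add_right sum.distrib sum_distrib_left)
      show ?thesis
        unfolding *[OF y] *[OF y'] *[OF z] sums by (simp add: algebra_simps)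
    qed
    then show "\<exists>z\<in>Y. \<forall>p\<in>feasible T A B C. a * cost p y + (1 - a) * cost p y' \<le> cost p z"
      using z by blast
  qed
  then show ?thesis
    by (simp add: amb cost_def case_prod_unfold image_comp)
qed

end
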